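(* Let $\mathcal P$ be a primitive integral cubic packing in which every curvature is congruent modulo $4$ to one of $0,1,2$. For tangent circles $\mathcal C,\mathcal C'$ of $\mathcal P$ with curvatures $a\neq0$ and $b$ satisfying $\gcd(a,b)=1$, put $\rho=a+b$ and $$\chi(\mathcal C,\mathcal C')=\begin{cases}\left(\frac{\rho}{a}\right) & a\equiv 0,1\pmod 4,\\ \left(\frac{-\rho}{a/2}\right) & a\equiv 2\pmod 4.\end{cases}$$ Suppose $\chi(\mathcal C,\mathcal C')=-1$ for every such pair. Then no circle of $\mathcal P$ has curvature of the form $n^2$ or $2n^2$ with $n$ an integer.
   Context: Generalized circles are circles and lines in the extended plane; each circle of a packing has signed curvature: $0$ for a line, $1/r$ for a circle of radius $r$, and $-1/r$ for a circle containing all other circles of the packing. A cubic configuration is a set of eight generalized circles with pairwise disjoint interiors, any two tangent or disjoint, whose tangency graph is the graph of the cube; for each of the 6 square faces there is a dual circle through the four tangency points of the circles of that face, orthogonal to them (such configurations exist and are unique up to Möbius transformations). The cubic Apollonian group is generated by the inversions in the 6 dual circles; the cubic packing is the union of the orbit of the eight circles. The packing is integral if all curvatures are integers and primitive if their gcd is $1$. $\left(\frac{m}{n}\right)$ is the Kronecker symbol: Legendre symbol for $n$ an odd prime; $\left(\frac m2\right)=0,1,-1$ according as $m$ is even, $\equiv\pm1$, or $\equiv\pm3\pmod 8$; $\left(\frac m{-1}\right)=1$ if $m\ge0$, $-1$ if $m<0$; $\left(\frac m1\right)=1$; multiplicative in $n$. *)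

theory Defs
  imports "HOL-Analysis.Analysis" "HOL-Number_Theory.Number_Theory"
begin

section \<open>Generalized circles in the extended plane\<close>

text \<open>The extended plane is the complex plane with one extra point at infinity, \<^term>\<open>None\<close>.
  A generalized circle is identified with its set of points.\<close>

type_synonym eplane = "complex option"

definition circ :: "complex \<Rightarrow> real \<Rightarrow> eplane set" where
  "circ c r = Some ` sphere c r"

definition eline :: "complex \<Rightarrow> complex \<Rightarrow> eplane set" where
  "eline p u = insert None (Some ` {p + of_real t * u |t :: real. True})"

definition is_line :: "eplane set \<Rightarrow> bool" where
  "is_line C \<longleftrightarrow> (\<exists>p u. u \<noteq> 0 \<and> C = eline p u)"

definition is_circle :: "eplane set \<Rightarrow> bool" where
  "is_circle C \<longleftrightarrow> (\<exists>c r. r > 0 \<and> C = circ c r)"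

definition gen_circle :: "eplane set \<Rightarrow> bool" where
  "gen_circle C \<longleftrightarrow> is_circle C \<or> is_line C"

text \<open>\<open>side C S\<close>: \<open>S\<close> is one of the two components of the complement of \<open>C\<close> in the extended
  plane, i.e. one of the two possible interiors of \<open>C\<close>.\<close>

inductive side :: "eplane set \<Rightarrow> eplane set \<Rightarrow> bool" where
  disc: "r > 0 \<Longrightarrow> side (circ c r) (Some ` ball c r)"
| codisc: "r > 0 \<Longrightarrow> side (circ c r) (- (Some ` cball c r))"
| left: "u \<noteq> 0 \<Longrightarrow> side (eline p u) (Some ` {z. Im ((z - p) / u) > 0})"
| right: "u \<noteq> 0 \<Longrightarrow> side (eline p u) (Some ` {z. Im ((z - p) / u) < 0})"

text \<open>Parallel lines are tangent at infinity.\<close>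

definition tangent :: "eplane set \<Rightarrow> eplane set \<Rightarrow> bool" where
  "tangent C D \<longleftrightarrow> (\<exists>x. C \<inter> D = {x})"

inductive orthogonal_circles :: "eplane set \<Rightarrow> eplane set \<Rightarrow> bool" where
  circ_circ: "r > 0 \<Longrightarrow> s > 0 \<Longrightarrow> (dist c d)\<^sup>2 = r\<^sup>2 + s\<^sup>2 \<Longrightarrow> orthogonal_circles (circ c r) (circ d s)"
| circ_line: "r > 0 \<Longrightarrow> u \<noteq> 0 \<Longrightarrow> Some c \<in> eline p u \<Longrightarrow> orthogonal_circles (circ c r) (eline p u)"
| line_circ: "r > 0 \<Longrightarrow> u \<noteq> 0 \<Longrightarrow> Some c \<in> eline p u \<Longrightarrow> orthogonal_circles (eline p u) (circ c r)"
| line_line: "u \<noteq> 0 \<Longrightarrow> w \<noteq> 0 \<Longrightarrow> orthogonal u w \<Longrightarrow> orthogonal_circles (eline p u) (eline q w)"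

definition circ_inversion :: "complex \<Rightarrow> real \<Rightarrow> eplane \<Rightarrow> eplane" where
  "circ_inversion c r x =
     (case x of
        None \<Rightarrow> Some c
      | Some z \<Rightarrow> if z = c then None else Some (c + of_real (r\<^sup>2) / cnj (z - c)))"

definition line_reflection :: "complex \<Rightarrow> complex \<Rightarrow> eplane \<Rightarrow> eplane" where
  "line_reflection p u = map_option (\<lambda>z. p + u * cnj ((z - p) / u))"

inductive inversion_in :: "eplane set \<Rightarrow> (eplane \<Rightarrow> eplane) \<Rightarrow> bool" where
  circle: "r > 0 \<Longrightarrow> inversion_in (circ c r) (circ_inversion c r)"
| line: "u \<noteq> 0 \<Longrightarrow> inversion_in (eline p u) (line_reflection p u)"


section \<open>Cubic configurations and packings\<close>

type_synonym cube_vertex = "bool \<times> bool \<times> bool"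

fun cube_adj :: "cube_vertex \<Rightarrow> cube_vertex \<Rightarrow> bool" where
  "cube_adj (x, y, z) (x', y', z') \<longleftrightarrow>
     of_bool (x \<noteq> x') + of_bool (y \<noteq> y') + of_bool (z \<noteq> z') = (1 :: nat)"

definition cube_faces :: "cube_vertex set set" where
  "cube_faces = (\<Union>b. {{b} \<times> UNIV \<times> UNIV, UNIV \<times> {b} \<times> UNIV, UNIV \<times> UNIV \<times> {b}})"

definition dual_circle :: "(cube_vertex \<Rightarrow> eplane set) \<Rightarrow> cube_vertex set \<Rightarrow> eplane set \<Rightarrow> bool" where
  "dual_circle C F D \<longleftrightarrow>
     gen_circle D \<and>
     (\<forall>v\<in>F. \<forall>w\<in>F. cube_adj v w \<longrightarrow> C v \<inter> C w \<subseteq> D) \<and>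
     (\<forall>v\<in>F. orthogonal_circles D (C v))"

text \<open>The existence of the orthogonal dual circles is a genuine part of the definition: the
  tangency graph alone does not determine the configuration up to Moebius transformations, since
  the four tangency points of a face always lie on a circle, but in general not on one that is
  orthogonal to the four circles of the face.\<close>

definition cubic_configuration :: "(cube_vertex \<Rightarrow> eplane set) \<Rightarrow> bool" where
  "cubic_configuration C \<longleftrightarrow>
     inj C \<and> (\<forall>v. gen_circle (C v)) \<and>
     (\<exists>I. (\<forall>v. side (C v) (I v)) \<and> (\<forall>v w. v \<noteq> w \<longrightarrow> I v \<inter> I w = {})) \<and>
     (\<forall>v w. v \<noteq> w \<longrightarrow> (if cube_adj v w then tangent (C v) (C w) else C v \<inter> C w = {})) \<and>
     (\<forall>F\<in>cube_faces. \<exists>D. dual_circle C F D)"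

text \<open>Inversions are involutions, so the group they generate is the monoid they generate.\<close>

inductive_set cubic_group :: "(cube_vertex \<Rightarrow> eplane set) \<Rightarrow> (eplane \<Rightarrow> eplane) set"
  for C :: "cube_vertex \<Rightarrow> eplane set" where
  one: "id \<in> cubic_group C"
| step: "g \<in> cubic_group C \<Longrightarrow> F \<in> cube_faces \<Longrightarrow> dual_circle C F D \<Longrightarrow> inversion_in D s
     \<Longrightarrow> s \<circ> g \<in> cubic_group C"

text \<open>The packing is represented by the set of its circles.\<close>

definition cubic_packing :: "eplane set set \<Rightarrow> bool" where
  "cubic_packing P \<longleftrightarrow>
     (\<exists>C. cubic_configuration C \<and> P = {g ` C v |g v. g \<in> cubic_group C})"

definition radius :: "eplane set \<Rightarrow> real" where
  "radius C = (THE r. r > 0 \<and> (\<exists>c. C = circ c r))"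

definition encloses :: "eplane set \<Rightarrow> eplane set \<Rightarrow> bool" where
  "encloses C D \<longleftrightarrow> (\<exists>c r. r > 0 \<and> C = circ c r \<and> D \<subseteq> Some ` cball c r)"

definition curvature :: "eplane set set \<Rightarrow> eplane set \<Rightarrow> real" where
  "curvature P C =
     (if is_line C then 0
      else if \<forall>D\<in>P - {C}. encloses C D then - 1 / radius C
      else 1 / radius C)"

definition integral_packing :: "eplane set set \<Rightarrow> bool" where
  "integral_packing P \<longleftrightarrow> (\<forall>C\<in>P. curvature P C \<in> \<int>)"

definition primitive_packing :: "eplane set set \<Rightarrow> bool" where
  "primitive_packing P \<longleftrightarrow> Gcd {k :: int. \<exists>C\<in>P. curvature P C = of_int k} = 1"


section \<open>The Kronecker symbol\<close>

definition kronecker_prime :: "int \<Rightarrow> int \<Rightarrow> int" where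
  "kronecker_prime m p =
     (if p = 2 then (if even m then 0 else if m mod 8 = 1 \<or> m mod 8 = 7 then 1 else - 1)
      else Legendre m p)"

text \<open>The value at \<open>n = 0\<close> is the customary one.\<close>

definition kronecker :: "int \<Rightarrow> int \<Rightarrow> int" where
  "kronecker m n =
     (if n = 0 then (if \<bar>m\<bar> = 1 then 1 else 0)
      else (if n < 0 \<and> m < 0 then - 1 else 1) *
           (\<Prod>p\<in>prime_factors n. kronecker_prime m p ^ multiplicity p n))"

text \<open>\<open>chi_value a b\<close> is the value of \<open>\<chi>\<close> at a pair of tangent circles of curvatures \<open>a\<close> and \<open>b\<close>.
  It is meaningful only for \<open>a mod 4 \<noteq> 3\<close>.\<close>

definition chi_value :: "int \<Rightarrow> int \<Rightarrow> int" where
  "chi_value a b =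
     (if a mod 4 = 2 then kronecker (- (a + b)) (a div 2) else kronecker (a + b) a)"

end

theory Submission
  imports Defs
begin

text \<open>In inversive coordinates circles are unit vectors of a Lorentzian form on a four-dimensional
  space, and inversions are reflections. The dual circles force the eight vectors of a cubic
  configuration to be \<open>W \<plusminus> E\<^sub>1 \<plusminus> E\<^sub>2 \<plusminus> E\<^sub>3\<close> for an orthogonal frame with \<open>\<langle>W, W\<rangle> = - 2\<close> and \<open>\<langle>E\<^sub>i, E\<^sub>i\<rangle> = 1\<close>,
  so that the cubic group acts on integral coordinate vectors. For a circle of curvature \<open>a\<close>, the
  sums \<open>\<rho> = a + b\<close> over its neighbours are values of a binary form of discriminant \<open>- 8 a\<^sup>2\<close>, which
  takes a value prime to \<open>a\<close> when the packing is primitive. If \<open>a = n\<^sup>2\<close>, or \<open>a = 2 n\<^sup>2\<close> with \<open>n\<close> odd,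
  the symbol has a square lower entry and is \<open>1\<close> for that neighbour. If \<open>a = 2 n\<^sup>2\<close> with \<open>n\<close> even it
  reduces to the symbol of \<open>\<rho>\<close> over \<open>2\<close>; here \<open>- 2\<close> is a square modulo \<open>\<rho>\<close>, hence \<open>\<rho> \<equiv> 1, 3\<close> modulo \<open>8\<close>,
  and \<open>\<rho> \<equiv> 1\<close> modulo \<open>4\<close> by the hypothesis on curvatures, so it is \<open>1\<close> again. For a line the form
  degenerates to a square, and some neighbour has a nonzero square curvature.\<close>

section \<open>Inversive coordinates\<close>

text \<open>The signed curvature of a circle depends on the whole packing, so it cannot be read off
  a vector before the orbit is known to have pairwise disjoint interiors. Hence the word argument in
  the reflection group: distinct orbit vectors have product at most -1, and their
  \<open>W\<close>-coordinate stays positive, which fixes the orientation. Only then is the first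
  coordinate the curvature. Orthogonality to a dual circle leaves one parameter per face; comparing
  the parameters around antipodal corners forces them to be 1. The norm -2 is what makes the eight
  sign combinations unit vectors (-2 + 3 = 1) with product -2 + 1 = -1 along the edges. The
  discriminant comes from expanding the null vector of the point at infinity in the frame. This is a
  quadratic relation among curvatures; in terms of \<open>a\<close> and the sums for three
  neighbours it reads \<open>(Z - X - Y)^2 = 4 * (X * Y - 2 * a^2)\<close>.\<close>

type_synonym vec = "real \<times> real \<times> real \<times> real"

text \<open>A vector \<open>(k, h, x, y)\<close> has curvature \<open>k\<close>; for \<open>k \<noteq> 0\<close> its centre is \<open>(x + \<i> y) / k\<close>, and \<open>h\<close> is the
  curvature of its image under inversion in the unit circle. Points are the null vectors.\<close>

definition mink :: "vec \<Rightarrow> vec \<Rightarrow> real" where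
  "mink u v = (case u of (k, h, x, y) \<Rightarrow> case v of (k', h', x', y') \<Rightarrow>
     x * x' + y * y' - (k * h' + h * k') / 2)"

fun pt :: "eplane \<Rightarrow> vec" where
  "pt None = (0, 1, 0, 0)"
| "pt (Some z) = (1, (Re z)\<^sup>2 + (Im z)\<^sup>2, Re z, Im z)"

definition locus :: "vec \<Rightarrow> eplane set" where
  "locus u = {p. mink u (pt p) = 0}"

text \<open>\<open>u\<close> and \<open>- u\<close> have the same locus; the sign chooses the
  interior. The sign of the product is meaningful because all \<open>pt p\<close> are normalised to
  the same half of the null cone.\<close>

definition pos_side :: "vec \<Rightarrow> eplane set" where
  "pos_side u = {p. mink u (pt p) > 0}"

lemma mink_coords [simp]:
  "mink (k, h, x, y) (k', h', x', y') = x * x' + y * y' - (k * h' + h * k') / 2"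
  by (simp add: mink_def)

lemma mink_commute: "mink u v = mink v u"
  by (cases u; cases v) (simp add: algebra_simps)

lemma mink_add_left: "mink (u + v) w = mink u w + mink v w"
  and mink_diff_left: "mink (u - v) w = mink u w - mink v w"
  and mink_scale_left: "mink (c *\<^sub>R u) w = c * mink u w"
  and mink_minus_left: "mink (- u) w = - mink u w"
  by (cases u; cases v; cases w; simp add: algebra_simps add_divide_distrib diff_divide_distrib)+

lemma mink_add_right: "mink w (u + v) = mink w u + mink w v"
  and mink_diff_right: "mink w (u - v) = mink w u - mink w v"
  and mink_scale_right: "mink w (c *\<^sub>R u) = c * mink w u"
  and mink_minus_right: "mink w (- u) = - mink w u"
  using mink_commute mink_add_left mink_diff_left mink_scale_left mink_minus_left by metis+

lemmas mink_linear = mink_add_left mink_diff_left mink_scale_left mink_minus_left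
  mink_add_right mink_diff_right mink_scale_right mink_minus_right

lemma mink_zero [simp]: "mink 0 u = 0" "mink u 0 = 0"
  by (cases u; simp add: zero_prod_def)+

lemma mink_nondegenerate:
  assumes "\<And>v. mink u v = 0"
  shows "u = 0"
proof -
  obtain k h x y where u: "u = (k, h, x, y)" by (cases u)
  show ?thesis
    using assms[of "(1, 0, 0, 0)"] assms[of "(0, 1, 0, 0)"] assms[of "(0, 0, 1, 0)"]
      assms[of "(0, 0, 0, 1)"]
    by (simp add: u zero_prod_def)
qed

lemma locus_minus [simp]: "locus (- u) = locus u"
  by (simp add: locus_def mink_linear)

section \<open>Vectors of circles and lines, and their two sides\<close>

definition circ_vec :: "complex \<Rightarrow> real \<Rightarrow> vec" where
  "circ_vec c r = (1 / r, ((Re c)\<^sup>2 + (Im c)\<^sup>2 - r\<^sup>2) / r, Re c / r, Im c / r)"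

text \<open>The last two coordinates are the unit normal \<open>\<i> * u / cmod u\<close>, and the
  second is twice the offset of the line along it.\<close>

definition line_vec :: "complex \<Rightarrow> complex \<Rightarrow> vec" where
  "line_vec p u = (0, 2 * (Re u * Im p - Im u * Re p) / cmod u, - Im u / cmod u, Re u / cmod u)"

lemma circ_vec_unit: "r \<noteq> 0 \<Longrightarrow> mink (circ_vec c r) (circ_vec c r) = 1"
  by (simp add: circ_vec_def field_simps power2_eq_square)

lemma line_vec_unit: "u \<noteq> 0 \<Longrightarrow> mink (line_vec p u) (line_vec p u) = 1"
  by (simp add: line_vec_def field_simps power2_eq_square flip: cmod_power2)
     (simp add: cmod_def power2_eq_square[symmetric])

text \<open>Up to the factor -1/(2r) this is the power of the point \<open>z\<close>, so its sign
  separates inside from outside.\<close>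

lemma mink_circ_vec:
  "r \<noteq> 0 \<Longrightarrow> mink (circ_vec c r) (pt (Some z)) = (r\<^sup>2 - (dist c z)\<^sup>2) / (2 * r)"
  unfolding dist_complex_def cmod_power2
  by (simp add: circ_vec_def field_simps power2_eq_square)

lemma mink_circ_vec_None [simp]: "mink (circ_vec c r) (pt None) = - 1 / (2 * r)"
  by (simp add: circ_vec_def)

lemma mink_line_vec:
  "u \<noteq> 0 \<Longrightarrow> mink (line_vec p u) (pt (Some z)) = cmod u * Im ((z - p) / u)"
proof -
  assume "u \<noteq> 0"
  then have "Im ((z - p) / u) = (Im (z - p) * Re u - Re (z - p) * Im u) / (cmod u)\<^sup>2"
    by (simp add: Im_divide cmod_power2)
  then have *: "cmod u * Im ((z - p) / u) = (Im (z - p) * Re u - Re (z - p) * Im u) / cmod u"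
    using \<open>u \<noteq> 0\<close> by (simp add: power2_eq_square)
  show ?thesis
    unfolding * using \<open>u \<noteq> 0\<close> by (simp add: line_vec_def field_simps)
qed

lemma mink_line_vec_None [simp]: "mink (line_vec p u) (pt None) = 0"
  by (simp add: line_vec_def)

lemma locus_circ_vec: "r > 0 \<Longrightarrow> locus (circ_vec c r) = circ c r"
proof -
  assume r: "r > 0"
  have "p \<in> locus (circ_vec c r) \<longleftrightarrow> p \<in> circ c r" for p
  proof (cases p)
    case None
    with r show ?thesis by (simp add: locus_def circ_def del: pt.simps)
  next
    case (Some z)
    have "r\<^sup>2 = (dist c z)\<^sup>2 \<longleftrightarrow> dist c z = r"
      using r by auto
    with r Some show ?thesis
      by (auto simp: locus_def circ_def mink_circ_vec simp del: pt.simps)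
  qed
  then show ?thesis by auto
qed

lemma pos_side_circ_vec: "r > 0 \<Longrightarrow> pos_side (circ_vec c r) = Some ` ball c r"
proof -
  assume r: "r > 0"
  have "p \<in> pos_side (circ_vec c r) \<longleftrightarrow> p \<in> Some ` ball c r" for p
  proof (cases p)
    case None
    with r show ?thesis by (simp add: pos_side_def del: pt.simps)
  next
    case (Some z)
    have "(dist c z)\<^sup>2 < r\<^sup>2 \<longleftrightarrow> dist c z < r"
      using r power_mono_iff[of r "dist c z" 2] by (simp flip: not_le)
    with r Some show ?thesis
      by (auto simp: pos_side_def mink_circ_vec zero_less_divide_iff simp del: pt.simps)
  qed
  then show ?thesis by auto
qed

lemma pos_side_minus: "pos_side (- u) = - (locus u \<union> pos_side u)"
  by (auto simp: pos_side_def locus_def mink_linear)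

lemma pos_side_minus_circ_vec: "r > 0 \<Longrightarrow> pos_side (- circ_vec c r) = - (Some ` cball c r)"
  by (simp add: pos_side_minus locus_circ_vec pos_side_circ_vec circ_def flip: image_Un sphere_cball)
     (simp add: sphere_def ball_def cball_def set_eq_iff image_iff, force)

lemma locus_line_vec: "u \<noteq> 0 \<Longrightarrow> locus (line_vec p u) = eline p u"
proof -
  assume u: "u \<noteq> 0"
  have "q \<in> locus (line_vec p u) \<longleftrightarrow> q \<in> eline p u" for q
  proof (cases q)
    case None
    then show ?thesis by (simp add: locus_def eline_def del: pt.simps)
  next
    case (Some z)
    have "Im ((z - p) / u) = 0 \<longleftrightarrow> (\<exists>t. z = p + of_real t * u)"
    proof
      assume "Im ((z - p) / u) = 0"
      then have "(z - p) / u = of_real (Re ((z - p) / u))"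
        by (simp add: complex_eq_iff)
      with u have "z = p + of_real (Re ((z - p) / u)) * u"
        by (metis add_diff_cancel_left' add.commute diff_add_cancel nonzero_eq_divide_eq)
      then show "\<exists>t. z = p + of_real t * u" ..
    qed (use u in auto)
    with u Some show ?thesis
      by (auto simp: locus_def eline_def mink_line_vec simp del: pt.simps)
  qed
  then show ?thesis by auto
qed

lemma pos_side_line_vec:
  assumes "u \<noteq> 0"
  shows "pos_side (line_vec p u) = Some ` {z. Im ((z - p) / u) > 0}"
    and "pos_side (- line_vec p u) = Some ` {z. Im ((z - p) / u) < 0}"
proof -
  have "q \<in> pos_side (line_vec p u) \<longleftrightarrow> q \<in> Some ` {z. Im ((z - p) / u) > 0}"
    "q \<in> pos_side (- line_vec p u) \<longleftrightarrow> q \<in> Some ` {z. Im ((z - p) / u) < 0}" for q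
    using assms by (cases q; auto simp: pos_side_def mink_line_vec mink_linear zero_less_mult_iff
        mult_less_0_iff simp del: pt.simps)+
  then show "pos_side (line_vec p u) = Some ` {z. Im ((z - p) / u) > 0}"
    "pos_side (- line_vec p u) = Some ` {z. Im ((z - p) / u) < 0}" by auto
qed

lemma side_imp_vec:
  assumes "side C S"
  obtains u where "mink u u = 1" "locus u = C" "pos_side u = S"
  using assms
proof cases
  case (disc r c)
  with that[of "circ_vec c r"] show ?thesis
    by (simp add: circ_vec_unit locus_circ_vec pos_side_circ_vec)
next
  case (codisc r c)
  with that[of "- circ_vec c r"] show ?thesis
    by (simp add: circ_vec_unit locus_circ_vec pos_side_minus_circ_vec mink_linear)
next
  case (left u p)
  with that[of "line_vec p u"] show ?thesis
    by (simp add: line_vec_unit locus_line_vec pos_side_line_vec)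
next
  case (right u p)
  with that[of "- line_vec p u"] show ?thesis
    by (simp add: line_vec_unit locus_line_vec pos_side_line_vec mink_linear)
qed

lemma gen_circle_imp_vec:
  assumes "gen_circle C"
  obtains u where "mink u u = 1" "locus u = C"
  using assms unfolding gen_circle_def is_circle_def is_line_def
  by (metis circ_vec_unit locus_circ_vec line_vec_unit locus_line_vec less_irrefl)

text \<open>Norm 1 means k h = x^2 + y^2 - 1, so for nonzero k the second coordinate is determined
  by the other three.\<close>

lemma unit_eq_circ_vec:
  assumes "mink u u = 1" "fst u \<noteq> 0"
  obtains c r where "r > 0" "fst u = 1 / r" "u = circ_vec c r"
  | c r where "r > 0" "fst u = - (1 / r)" "u = - circ_vec c r"
proof -
  obtain k h x y where u: "u = (k, h, x, y)" by (cases u)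
  have k: "k \<noteq> 0" using assms(2) by (simp add: u)
  have "x * x + y * y - (k * h + h * k) / 2 = 1" using assms(1) by (simp add: u)
  then have "k * h = x\<^sup>2 + y\<^sup>2 - 1" by (simp add: power2_eq_square mult.commute[of h k])
  then have h: "h = (x\<^sup>2 + y\<^sup>2 - 1) / k" using k by (metis nonzero_mult_div_cancel_left)
  have e: "circ_vec (Complex (x / k) (y / k)) (1 / k) = u"
    using k by (simp add: u h circ_vec_def power_divide)
       (simp add: power2_eq_square left_diff_distrib distrib_right diff_divide_distrib add_divide_distrib)
  show ?thesis
  proof (cases "k > 0")
    case True
    then show ?thesis using that(1)[of "1 / k" "Complex (x / k) (y / k)"] e by (simp add: u)
  next
    case False
    then have "0 < - 1 / k" "fst u = - (1 / (- 1 / k))" using k by (simp_all add: u)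
    moreover have "u = - circ_vec (Complex (x / k) (y / k)) (- 1 / k)"
      unfolding e[symmetric] by (simp add: circ_vec_def)
    ultimately show ?thesis by (rule that(2))
  qed
qed

lemma unit_eq_line_vec:
  assumes "mink u u = 1" "fst u = 0"
  obtains p w where "cmod w = 1" "u = line_vec p w"
proof -
  obtain k h x y where u: "u = (k, h, x, y)" by (cases u)
  have n: "x\<^sup>2 + y\<^sup>2 = 1" and k: "k = 0" 
    using assms by (auto simp: u power2_eq_square)
  have w: "cmod (Complex y (- x)) = 1"
    using n by (simp add: cmod_def add.commute)
  have "h * (x * x) + h * (y * y) = h"
    using n by (simp add: power2_eq_square flip: distrib_left)
  then have "u = line_vec (Complex (h / 2 * x) (h / 2 * y)) (Complex y (- x))"
    by (simp add: u line_vec_def w k algebra_simps)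
  with w that show ?thesis by blast
qed

lemma locus_line_iff:
  assumes "mink u u = 1"
  shows "is_line (locus u) \<longleftrightarrow> fst u = 0"
proof
  assume "is_line (locus u)"
  then have "None \<in> locus u" by (auto simp: is_line_def eline_def)
  then show "fst u = 0" by (cases u) (simp add: locus_def)
next
  assume "fst u = 0"
  then obtain p w where "cmod w = 1" "u = line_vec p w"
    using unit_eq_line_vec assms by blast
  then show "is_line (locus u)"
    by (metis is_line_def locus_line_vec norm_zero zero_neq_one)
qed

text \<open>The ends of two perpendicular diameters of one circle are equidistant from the other
  centre; differences of the squared distances force equal centres.\<close>

lemma circ_eq_iff:
  assumes "r > 0" "s > 0"
  shows "circ c r = circ d s \<longleftrightarrow> c = d \<and> r = s"
proof
  assume "circ c r = circ d s"
  then have "sphere c r = sphere d s"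
    by (simp add: circ_def inj_image_eq_iff)
  then have *: "(cmod (d - z))\<^sup>2 = s\<^sup>2" if "z \<in> sphere c r" for z
    using that by (simp add: dist_complex_def)
  have "c + of_real r \<in> sphere c r" "c - of_real r \<in> sphere c r"
    "c + \<i> * of_real r \<in> sphere c r" "c - \<i> * of_real r \<in> sphere c r"
    using assms by (simp_all add: dist_complex_def norm_mult)
  note this [THEN *]
  then have "(Re d - Re c - r)\<^sup>2 + (Im d - Im c)\<^sup>2 = s\<^sup>2" "(Re d - Re c + r)\<^sup>2 + (Im d - Im c)\<^sup>2 = s\<^sup>2"
    "(Re d - Re c)\<^sup>2 + (Im d - Im c - r)\<^sup>2 = s\<^sup>2" "(Re d - Re c)\<^sup>2 + (Im d - Im c + r)\<^sup>2 = s\<^sup>2"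
    by (simp_all add: cmod_power2 algebra_simps)
  note eqs = this
  have "r * (Re d - Re c) = 0" "r * (Im d - Im c) = 0"
  proof -
    have "(Re d - Re c + r)\<^sup>2 - (Re d - Re c - r)\<^sup>2 = 4 * (r * (Re d - Re c))"
      "(Im d - Im c + r)\<^sup>2 - (Im d - Im c - r)\<^sup>2 = 4 * (r * (Im d - Im c))"
      by (simp_all add: power2_eq_square algebra_simps)
    moreover have "(Re d - Re c + r)\<^sup>2 = (Re d - Re c - r)\<^sup>2"
      by (rule add_right_imp_eq[of _ "(Im d - Im c)\<^sup>2"]) (simp only: eqs)
    moreover have "(Im d - Im c + r)\<^sup>2 = (Im d - Im c - r)\<^sup>2"
      by (rule add_left_imp_eq[of "(Re d - Re c)\<^sup>2"]) (simp only: eqs)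
    ultimately show "r * (Re d - Re c) = 0" "r * (Im d - Im c) = 0" by simp_all
  qed
  with assms have "d = c" by (simp add: complex_eq_iff)
  with eqs(1) assms show "c = d \<and> r = s" by simp
qed simp

lemma fst_circ_vec [simp]: "fst (circ_vec c r) = 1 / r"
  by (simp add: circ_vec_def)

lemma fst_line_vec [simp]: "fst (line_vec p u) = 0"
  by (simp add: line_vec_def)

section \<open>Products of circle vectors and relative position\<close>

lemma mink_circ_circ:
  assumes "r \<noteq> 0" "s \<noteq> 0"
  shows "mink (circ_vec c r) (circ_vec d s) = (r\<^sup>2 + s\<^sup>2 - (dist c d)\<^sup>2) / (2 * r * s)"
  using assms unfolding dist_complex_def cmod_power2
  by (simp add: circ_vec_def field_simps power2_eq_square)

lemma mink_line_circ:
  assumes "r \<noteq> 0" "u \<noteq> 0"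
  shows "mink (line_vec p u) (circ_vec c r) = cmod u * Im ((c - p) / u) / r"
proof -
  have "mink (line_vec p u) (circ_vec c r) = mink (line_vec p u) (pt (Some c)) / r"
    using assms by (simp add: line_vec_def circ_vec_def field_simps)
  with assms show ?thesis by (simp add: mink_line_vec del: pt.simps)
qed

lemma mink_circ_line:
  assumes "r \<noteq> 0" "u \<noteq> 0"
  shows "mink (circ_vec c r) (line_vec p u) = cmod u * Im ((c - p) / u) / r"
  using mink_line_circ[OF assms] by (simp add: mink_commute)

lemma mink_line_line:
  assumes "u \<noteq> 0" "w \<noteq> 0"
  shows "mink (line_vec p u) (line_vec q w) = (u \<bullet> w) / (cmod u * cmod w)"
  using assms by (simp add: line_vec_def inner_complex_def field_simps)

text \<open>Translation of the origin to \<open>z\<close> is an isometry: the brackets are the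
  translated last coordinates, and \<open>- 2 * mink u (pt (Some z))\<close> is the translated
  second one. For two circles through \<open>z\<close> only the inner product of their normals at
  \<open>z\<close> remains.\<close>

lemma mink_at_point:
  "mink (k, h, x, y) (k', h', x', y') =
     (x - k * Re z) * (x' - k' * Re z) + (y - k * Im z) * (y' - k' * Im z)
     + k * mink (k', h', x', y') (pt (Some z)) + k' * mink (k, h, x, y) (pt (Some z))"
  by (simp add: algebra_simps power2_eq_square add_divide_distrib diff_divide_distrib)

text \<open>At a shared point the product is the inner product of two unit normals, which is at
  least -1.\<close>

lemma common_point_imp_ge:
  assumes "mink u u = 1" "mink v v = 1" "p \<in> locus u" "p \<in> locus v"
  shows "mink u v \<ge> - 1"
proof -
  have *: "a * c + b * d \<ge> - 1" if "a * a + b * b = 1" "c * c + d * d = 1" for a b c d :: real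
    using that zero_le_square[of "a + c"] zero_le_square[of "b + d"]
    by (simp add: algebra_simps)
  obtain k h x y where u: "u = (k, h, x, y)" by (cases u)
  obtain k' h' x' y' where v: "v = (k', h', x', y')" by (cases v)
  show ?thesis
  proof (cases p)
    case None
    with assms *[of x y x' y'] show ?thesis by (auto simp: u v locus_def)
  next
    case (Some z)
    then have "mink u (pt (Some z)) = 0" "mink v (pt (Some z)) = 0"
      using assms by (auto simp: locus_def)
    with assms(1,2) show ?thesis
      using *[of "x - k * Re z" "y - k * Im z" "x' - k' * Re z" "y' - k' * Im z"]
      unfolding u v mink_at_point[of _ _ _ _ _ _ _ _ z] by (simp del: mink_coords pt.simps)
  qed
qed

lemma null_imp_pt:
  assumes "mink n n = 0" "n \<noteq> 0"
  obtains t p where "t \<noteq> 0" "n = t *\<^sub>R pt p"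
proof -
  obtain k h x y where n: "n = (k, h, x, y)" by (cases n)
  have e: "x * x + y * y = k * h" using assms by (simp add: n)
  show ?thesis
  proof (cases "k = 0")
    case True
    with e have "x = 0" "y = 0" by (auto simp: sum_squares_eq_zero_iff)
    with True that[of h None] assms n show ?thesis by (auto simp: zero_prod_def)
  next
    case False
    then have "n = k *\<^sub>R pt (Some (Complex (x / k) (y / k)))"
      using e by (simp add: n power2_eq_square field_simps)
    with False that show ?thesis by blast
  qed
qed

lemma mink_pt_eq_0_iff: "mink (pt p) (pt q) = 0 \<longleftrightarrow> p = q"
proof (cases p; cases q)
  fix z w assume p: "p = Some z" and q: "q = Some w"
  have "mink (pt (Some z)) (pt (Some w)) = (- 1 / 2) * ((Re z - Re w)\<^sup>2 + (Im z - Im w)\<^sup>2)"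
    by (simp add: power2_eq_square algebra_simps)
  then show ?thesis
    unfolding p q by (simp add: sum_power2_eq_zero_iff complex_eq_iff del: pt.simps)
qed auto

text \<open>\<open>u + v\<close> is null and orthogonal to both vectors, so it represents a common
  point. Any common point is orthogonal to it, and distinct points are never orthogonal. The
  condition \<open>u + v \<noteq> 0\<close> excludes one circle with its two orientations.\<close>

lemma mink_eq_minus_1_imp_tangent:
  assumes "mink u u = 1" "mink v v = 1" "mink u v = - 1" "u + v \<noteq> 0"
  shows "tangent (locus u) (locus v)"
proof -
  have m: "mink u (u + v) = 0" "mink v (u + v) = 0"
    using assms by (simp_all add: mink_linear mink_commute)
  then have "mink (u + v) (u + v) = 0" by (simp add: mink_add_left)
  with assms(4) obtain t p where t: "t \<noteq> 0" "u + v = t *\<^sub>R pt p"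
    using null_imp_pt by blast
  with m have "p \<in> locus u \<inter> locus v" by (simp add: mink_scale_right locus_def)
  moreover have "q = p" if "q \<in> locus u \<inter> locus v" for q
  proof -
    have "mink (u + v) (pt q) = 0" using that by (simp add: locus_def mink_add_left)
    with t show ?thesis by (simp add: mink_scale_left mink_pt_eq_0_iff)
  qed
  ultimately show ?thesis unfolding tangent_def by blast
qed

lemma unit_vec_cases:
  assumes "mink u u = 1"
  obtains (disc) c r where "r > 0" "fst u = 1 / r" "u = circ_vec c r"
  | (codisc) c r where "r > 0" "fst u = - (1 / r)" "u = - circ_vec c r"
  | (line) p w where "cmod w = 1" "fst u = 0" "u = line_vec p w"
  using unit_eq_circ_vec unit_eq_line_vec assms by metis

lemma disjoint_discs:
  assumes "r > 0" "s > 0" "ball c r \<inter> ball d s = {}"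
  shows "dist (c :: complex) d \<ge> r + s"
proof (rule ccontr)
  assume lt: "\<not> dist c d \<ge> r + s"
  \<comment> \<open>\<open>z\<close> will divide the segment in the ratio r : s, so its distances
    from the centres are r and s scaled by \<open>dist c d / (r + s) < 1\<close>.\<close>
  define q where "q = r / (r + s)"
  have q: "0 \<le> q" "q \<le> 1" "1 - q = s / (r + s)"
    using assms by (simp_all add: q_def field_simps)
  define z where "z = c + of_real q * (d - c)"
  have "c - z = - (of_real q * (d - c))" "d - z = of_real (1 - q) * (d - c)"
    by (simp_all add: z_def algebra_simps)
  then have "dist c z = q * dist c d" "dist d z = (1 - q) * dist c d"
    using q(1,2) unfolding dist_complex_def
    by (simp_all only: norm_minus_cancel norm_mult norm_of_real norm_minus_commute[of c d] abs_of_nonneg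
        diff_ge_0_iff_ge)
  then have "dist c z = r / (r + s) * dist c d" "dist d z = s / (r + s) * dist c d"
    by (simp_all only: q(3)) (simp only: q_def)
  with assms lt have "z \<in> ball c r" "z \<in> ball d s"
    by (simp_all add: pos_divide_less_eq)
  with assms show False by blast
qed

lemma Im_shift: "w \<noteq> 0 \<Longrightarrow> Im ((c + of_real t * (\<i> * w) - p) / w) = Im ((c - p) / w) + t"
proof -
  assume "w \<noteq> 0"
  then have "(c + of_real t * (\<i> * w) - p) / w = (c - p) / w + of_real t * \<i>"
    by (simp add: field_simps)
  then show ?thesis by simp
qed

lemma disjoint_pos_side_line:
  assumes w: "cmod w = 1" and v: "mink v v = 1" and dis: "pos_side (line_vec p w) \<inter> pos_side v = {}"
  shows "mink (line_vec p w) v \<le> - 1 \<and> fst v \<ge> 0"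
proof -
  have w0: "w \<noteq> 0" using w by auto
  have ii: "dist c (c + of_real t * (\<i> * w)) = \<bar>t\<bar>" for c t
    using w by (simp add: dist_complex_def norm_mult)
  show ?thesis
    using v
  proof (cases v rule: unit_vec_cases)
    case (disc c r)
    let ?I = "Im ((c - p) / w)"
    have "?I \<le> - r"
    proof (rule ccontr)
      assume "\<not> ?I \<le> - r"
      \<comment> \<open>If the centre is not in the half-plane, \<open>t\<close> is the midpoint
        between \<open>- ?I\<close> and \<open>r\<close>: moving the centre by \<open>t\<close>
        along the normal enters the half-plane without leaving the disc.\<close>
      define t where "t = (if ?I > 0 then 0 else (r - ?I) / 2)"
      have "\<bar>t\<bar> < r" "?I + t > 0"
        unfolding t_def using \<open>\<not> ?I \<le> - r\<close> \<open>r > 0\<close>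
        by (cases "?I > 0"; simp add: field_simps; linarith)+
      then have "Some (c + of_real t * (\<i> * w)) \<in> pos_side (line_vec p w) \<inter> pos_side v"
        using disc w0 by (simp add: pos_side_line_vec pos_side_circ_vec ii Im_shift)
      with dis show False by blast
    qed
    with disc w0 w show ?thesis by (simp add: mink_line_circ pos_divide_le_eq)
  next
    case (codisc c r)
    define t where "t = \<bar>Im ((c - p) / w)\<bar> + r + 1"
    have "\<bar>t\<bar> > r" "Im ((c - p) / w) + t > 0"
      using \<open>r > 0\<close> by (auto simp: t_def)
    then have "Some (c + of_real t * (\<i> * w)) \<in> pos_side (line_vec p w) \<inter> pos_side v"
      using codisc w0 by (auto simp: pos_side_line_vec pos_side_minus_circ_vec ii Im_shift)
    with dis show ?thesis by blast
  next
    case (line q w')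
    let ?u = "line_vec p w"
    have u: "mink ?u ?u = 1" "fst ?u = 0" using line_vec_unit[OF w0] by (simp_all add: line_vec_def)
    obtain k h x y where "?u = (k, h, x, y)" by (cases ?u)
    with u(2) have uc: "?u = (0, h, x, y)" by simp
    obtain k' h' x' y' where "v = (k', h', x', y')" by (cases v)
    with line(2) have vc: "v = (0, h', x', y')" by simp
    let ?c = "mink ?u v"
    have "?c \<le> - 1"
    proof (rule ccontr)
      assume "\<not> ?c \<le> - 1"
      \<comment> \<open>The sum of the two unit normals has product \<open>1 + ?c > 0\<close> with
        each of them, so far out in its direction lie points of both half-planes; \<open>t\<close>
        outweighs the offsets h/2 and h'/2.\<close>
      define t where "t = (\<bar>h\<bar> + \<bar>h'\<bar> + 1) / (1 + ?c)"
      have n: "x * x + y * y = 1" "x' * x' + y' * y' = 1" "x * x' + y * y' = ?c"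
        using u v by (simp_all add: uc vc)
      have t: "t * (1 + ?c) = \<bar>h\<bar> + \<bar>h'\<bar> + 1"
        using \<open>\<not> ?c \<le> - 1\<close> by (simp add: t_def)
      let ?z = "Complex (t * (x + x')) (t * (y + y'))"
      have "mink ?u (pt (Some ?z)) = t * ((x * x + y * y) + (x * x' + y * y')) - h / 2"
        "mink v (pt (Some ?z)) = t * ((x' * x' + y' * y') + (x * x' + y * y')) - h' / 2"
        by (simp_all add: uc vc algebra_simps)
      then have "Some ?z \<in> pos_side ?u \<inter> pos_side v"
        unfolding n t by (auto simp: pos_side_def simp del: pt.simps)
      with dis show False by blast
    qed
    with line show ?thesis by simp
  qed
qed

text \<open>Besides the product this records the sign of the curvature sum, which later fixes the
  sign of \<open>fst W\<close>. Two exteriors cannot occur, as they share the point at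
  infinity.\<close>

lemma disjoint_pos_side:
  assumes u: "mink u u = 1" and v: "mink v v = 1" and dis: "pos_side u \<inter> pos_side v = {}"
  shows "mink u v \<le> - 1 \<and> fst u + fst v \<ge> 0"
proof -
  have mixed: "mink (circ_vec c r) (- circ_vec d s) \<le> - 1 \<and> 1 / r - 1 / s \<ge> 0"
    if "r > 0" "s > 0" "pos_side (circ_vec c r) \<inter> pos_side (- circ_vec d s) = {}" for c d r s
  proof -
    have "ball c r \<subseteq> cball d s"
      using that by (auto simp: pos_side_circ_vec pos_side_minus_circ_vec)
    then have le: "dist c d + r \<le> s"
      using that by (simp add: ball_subset_cball_iff)
    then have "(dist c d)\<^sup>2 \<le> (s - r)\<^sup>2" by (intro power_mono) auto
    moreover have "r \<le> s" using le zero_le_dist[of c d] by linarith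
    ultimately show ?thesis
      using that by (simp add: mink_circ_circ mink_linear field_simps power2_eq_square)
  qed
  show ?thesis
    using u
  proof (cases u rule: unit_vec_cases)
    case u: (disc c r)
    show ?thesis
      using v
    proof (cases v rule: unit_vec_cases)
      case v: (disc d s)
      have "dist c d \<ge> r + s"
        using dis u v disjoint_discs[of r s c d] by (auto simp: pos_side_circ_vec)
      then have "(dist c d)\<^sup>2 \<ge> (r + s)\<^sup>2" using u v by (intro power_mono) auto
      with u v show ?thesis
        by (simp add: mink_circ_circ field_simps power2_eq_square)
    next
      case (codisc d s)
      with u mixed[of r s c d] dis show ?thesis by auto
    next
      case (line p w)
      with disjoint_pos_side_line[of w u p] assms dis show ?thesis
        by (auto simp: Int_commute mink_commute)
    qed
  next
    case u: (codisc c r)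
    show ?thesis
      using v
    proof (cases v rule: unit_vec_cases)
      case (disc d s)
      with u mixed[of s r d c] dis show ?thesis by (auto simp: mink_commute Int_commute)
    next
      case (codisc d s)
      with u dis have "None \<notin> pos_side (- circ_vec c r) \<inter> pos_side (- circ_vec d s)"
        by auto
      with u codisc show ?thesis by (auto simp: pos_side_minus_circ_vec)
    next
      case (line p w)
      with disjoint_pos_side_line[of w u p] assms dis show ?thesis
        by (auto simp: Int_commute mink_commute)
    qed
  next
    case (line p w)
    with disjoint_pos_side_line[of w v p] assms dis show ?thesis by auto
  qed
qed

lemma locus_eq_imp:
  assumes u: "mink u u = 1" and v: "mink v v = 1" and e: "locus u = locus v"
  shows "v = u \<or> v = - u"
proof (cases "fst u = 0")
  case False
  then have "fst v \<noteq> 0" using locus_line_iff e u v by metis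
  with v obtain d s where "s > 0" and v: "v = circ_vec d s \<or> v = - circ_vec d s"
    using unit_eq_circ_vec by metis
  from False u obtain c r where "r > 0" and u: "u = circ_vec c r \<or> u = - circ_vec c r"
    using unit_eq_circ_vec by metis
  have "circ c r = circ d s"
    using u v e \<open>r > 0\<close> \<open>s > 0\<close> by (auto simp: locus_circ_vec)
  with \<open>r > 0\<close> \<open>s > 0\<close> u v show ?thesis by (auto simp: circ_eq_iff)
next
  case True
  then have "fst v = 0" using locus_line_iff e u v by metis
  then obtain h' x' y' where vc: "v = (0, h', x', y')" by (cases v) auto
  obtain h x y where uc: "u = (0, h, x, y)" using True by (cases u) auto
  have n: "x * x + y * y = 1" "x' * x' + y' * y' = 1" using u v by (simp_all add: uc vc)
  \<comment> \<open>The points of the line, starting at the foot of the perpendicular from the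
    origin and moving by \<open>t\<close> along the direction. An equation valid for all
    \<open>t\<close> has slope 0, which makes the two normals parallel.\<close>
  have on: "Some (Complex (h / 2 * x - t * y) (h / 2 * y + t * x)) \<in> locus v" for t
  proof -
    have "mink u (pt (Some (Complex (h / 2 * x - t * y) (h / 2 * y + t * x)))) = h / 2 * (x * x + y * y) - h / 2"
      by (simp add: uc algebra_simps)
    then show ?thesis unfolding n e[symmetric] by (simp add: locus_def)
  qed
  have eq: "x' * (h / 2 * x - t * y) + y' * (h / 2 * y + t * x) = h' / 2" for t
    using on[of t] by (simp add: locus_def vc)
  have cross: "x * y' - y * x' = 0" using eq[of 0] eq[of 1] by (simp add: algebra_simps)
  have "x' = (x * x + y * y) * x'" "y' = (x * x + y * y) * y'" by (simp_all add: n)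
  then have "x' = x * (x * x' + y * y') - y * (x * y' - y * x')"
    "y' = y * (x * x' + y * y') + x * (x * y' - y * x')"
    by (simp_all add: algebra_simps)
  then have x': "x' = x * c" and y': "y' = y * c" if "c = x * x' + y * y'" for c
    using that by (simp_all add: cross)
  define c where "c = x * x' + y * y'"
  note xy = x'[OF c_def] y'[OF c_def]
  have h: "h' = h * c" using eq[of 0] by (simp add: c_def algebra_simps)
  have "c * c * (x * x + y * y) = (x * c) * (x * c) + (y * c) * (y * c)"
    by (simp add: algebra_simps)
  also have "\<dots> = 1" using n(2) unfolding xy[symmetric] .
  finally have "c = 1 \<or> c = - 1" by (simp add: n square_eq_1_iff)
  then show ?thesis by (auto simp: uc vc xy h)
qed

text \<open>A locus determines its unit vector up to sign, and orthogonality ignores signs, so it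
  suffices to check the standard vectors in the four cases.\<close>

lemma orthogonal_circles_imp:
  assumes o: "orthogonal_circles D C" and d: "mink d d = 1" "locus d = D"
    and u: "mink u u = 1" "locus u = C"
  shows "mink d u = 0"
proof -
  have "\<exists>d' u'. mink d' d' = 1 \<and> locus d' = D \<and> mink u' u' = 1 \<and> locus u' = C \<and> mink d' u' = 0"
    using o
  proof cases
    case (circ_circ r s c d)
    then show ?thesis
      by (intro exI[of _ "circ_vec c r"] exI[of _ "circ_vec d s"])
        (simp add: circ_vec_unit locus_circ_vec mink_circ_circ)
  next
    case (circ_line r u c p)
    then have "Some c \<in> locus (line_vec p u)" by (simp add: locus_line_vec)
    then have "Im ((c - p) / u) = 0"
      using circ_line by (simp add: locus_def mink_line_vec del: pt.simps)
    with circ_line show ?thesis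
      by (intro exI[of _ "circ_vec c r"] exI[of _ "line_vec p u"])
        (simp add: circ_vec_unit locus_circ_vec line_vec_unit locus_line_vec mink_circ_line)
  next
    case (line_circ r u c p)
    then have "Some c \<in> locus (line_vec p u)" by (simp add: locus_line_vec)
    then have "Im ((c - p) / u) = 0"
      using line_circ by (simp add: locus_def mink_line_vec del: pt.simps)
    with line_circ show ?thesis
      by (intro exI[of _ "line_vec p u"] exI[of _ "circ_vec c r"])
        (simp add: circ_vec_unit locus_circ_vec line_vec_unit locus_line_vec mink_line_circ)
  next
    case (line_line u w p q)
    then show ?thesis
      by (intro exI[of _ "line_vec p u"] exI[of _ "line_vec q w"])
        (simp add: line_vec_unit locus_line_vec mink_line_line orthogonal_def)
  qed
  then obtain d' u' where "mink d' d' = 1" "locus d' = D" "mink u' u' = 1" "locus u' = C" "mink d' u' = 0"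
    by blast
  with d u locus_eq_imp[of d' d] locus_eq_imp[of u' u] show ?thesis
    by (auto simp: mink_linear)
qed

lemma locus_two_points:
  assumes "mink u u = 1"
  obtains p q where "p \<in> locus u" "q \<in> locus u" "p \<noteq> q"
proof -
  have circ: "\<exists>p q. p \<in> circ c r \<and> q \<in> circ c r \<and> p \<noteq> q" if "r > 0" for c r
    using that by (intro exI[of _ "Some (c + of_real r)"] exI[of _ "Some (c - of_real r)"])
      (auto simp: circ_def dist_complex_def)
  have line: "\<exists>p q. p \<in> eline z w \<and> q \<in> eline z w \<and> p \<noteq> q" for z w
    by (intro exI[of _ "None"] exI[of _ "Some z"]) (auto simp: eline_def intro: exI[of _ 0])
  have "\<exists>p q. p \<in> locus u \<and> q \<in> locus u \<and> p \<noteq> q"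
    using assms
  proof (cases u rule: unit_vec_cases)
    case (line p w)
    then have "w \<noteq> 0" by auto
    then show ?thesis
      unfolding \<open>u = line_vec p w\<close> locus_line_vec[OF \<open>w \<noteq> 0\<close>]
      using \<open>\<And>z w. \<exists>p q. p \<in> eline z w \<and> q \<in> eline z w \<and> p \<noteq> q\<close> by blast
  qed (use circ in \<open>auto simp: locus_circ_vec\<close>)
  with that show ?thesis by blast
qed

section \<open>Inversions as Lorentzian reflections\<close>

definition vrefl :: "vec \<Rightarrow> vec \<Rightarrow> vec" where
  "vrefl d u = u - (2 * mink u d) *\<^sub>R d"

lemma mink_vrefl:
  assumes "mink d d = 1"
  shows "mink (vrefl d u) (vrefl d v) = mink u v"
  using assms by (simp add: vrefl_def mink_linear mink_commute[of d u] mink_commute[of d v])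

lemma vrefl_minus [simp]: "vrefl (- d) u = vrefl d u"
  by (simp add: vrefl_def mink_linear)

text \<open>An inversion is a reflection of the null cone read projectively. The scalar is 1 for a
  line, and |z - c|^2 / r^2 at a finite point \<open>z\<close> other than the centre
  \<open>c\<close> of a circle.\<close>

lemma inversion_pt:
  assumes "inversion_in D s" and d: "mink d d = 1" "locus d = D"
  shows "\<exists>t > 0. vrefl d (pt x) = t *\<^sub>R pt (s x)"
  using assms(1)
proof cases
  case (circle r c)
  then have "vrefl d = vrefl (circ_vec c r)"
    using locus_eq_imp[of "circ_vec c r" d] d by (auto simp: circ_vec_unit locus_circ_vec)
  moreover have "\<exists>t > 0. vrefl (circ_vec c r) (pt x) = t *\<^sub>R pt (circ_inversion c r x)"
  proof (cases x)
    case None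
    with circle show ?thesis
      by (intro exI[of _ "1 / r\<^sup>2"])
        (simp add: vrefl_def circ_inversion_def circ_vec_def field_simps power2_eq_square)
  next
    case (Some z)
    show ?thesis
    proof (cases "z = c")
      case True
      have "mink (pt (Some c)) (circ_vec c r) = r / 2"
        using circle mink_circ_vec[of r c c] by (simp add: mink_commute power2_eq_square del: pt.simps)
      have "vrefl (circ_vec c r) (pt x) = r\<^sup>2 *\<^sub>R pt (circ_inversion c r x)"
        unfolding vrefl_def Some True \<open>mink (pt (Some c)) (circ_vec c r) = r / 2\<close>
        using circle by (simp add: circ_inversion_def circ_vec_def power2_eq_square zero_prod_def)
      with circle show ?thesis by (intro exI[of _ "r\<^sup>2"]) simp
    next
      case False
      define a b where "a = Re z - Re c" and "b = Im z - Im c"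
      have zc: "z - c = Complex a b" by (simp add: a_def b_def complex_eq_iff)
      define n where "n = a\<^sup>2 + b\<^sup>2"
      have n: "n > 0" using False by (auto simp: n_def a_def b_def complex_eq_iff sum_power2_gt_zero_iff)
      have "(dist c z)\<^sup>2 = (cmod (z - c))\<^sup>2" by (simp add: dist_complex_def norm_minus_commute)
      then have "(dist c z)\<^sup>2 = n" by (simp add: zc cmod_power2 n_def)
      then have mk: "mink (pt (Some z)) (circ_vec c r) = (r\<^sup>2 - n) / (2 * r)"
        using circle mink_circ_vec[of r c z] by (simp add: mink_commute del: pt.simps)
      have "r\<^sup>2 / cnj (z - c) = Complex (r\<^sup>2 * a / n) (r\<^sup>2 * b / n)"
        by (simp add: zc complex_eq_iff Re_divide Im_divide n_def)
      then have s: "circ_inversion c r x = Some (Complex (Re c + r\<^sup>2 * a / n) (Im c + r\<^sup>2 * b / n))"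
        using False by (simp add: Some circ_inversion_def complex_eq_iff)
      have sq: "n / R * (p + R * t / n)\<^sup>2 = n / R * p\<^sup>2 + 2 * p * t + R * t\<^sup>2 / n" if "R > 0" for p t R :: real
        using n that by (simp add: power2_eq_square field_simps)
      have n1: "r\<^sup>2 * a\<^sup>2 / n + r\<^sup>2 * b\<^sup>2 / n = r\<^sup>2"
      proof -
        have "r\<^sup>2 * a\<^sup>2 / n + r\<^sup>2 * b\<^sup>2 / n = r\<^sup>2 * n / n"
          by (simp add: n_def distrib_left add_divide_distrib)
        with n show ?thesis by simp
      qed
      have z: "Re z = Re c + a" "Im z = Im c + b" by (simp_all add: a_def b_def)
      have r2: "r\<^sup>2 > 0" using circle by simp
      have 1: "2 * ((r\<^sup>2 - n) / (2 * r)) * (q / r) = q - n / r\<^sup>2 * q" for q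
        using circle by (simp add: power2_eq_square field_simps)
      have "vrefl (circ_vec c r) (pt x) =
          (n / r\<^sup>2, (Re z)\<^sup>2 + (Im z)\<^sup>2 - ((Re c)\<^sup>2 + (Im c)\<^sup>2 - r\<^sup>2 - n / r\<^sup>2 * ((Re c)\<^sup>2 + (Im c)\<^sup>2 - r\<^sup>2)),
           Re z - (Re c - n / r\<^sup>2 * Re c), Im z - (Im c - n / r\<^sup>2 * Im c))"
        unfolding vrefl_def Some mk by (simp add: circ_vec_def 1 del: times_divide_eq_right times_divide_eq_left)
      also have "\<dots> = (n / r\<^sup>2) *\<^sub>R pt (circ_inversion c r x)"
        unfolding s using sq[OF r2, of "Re c" a] sq[OF r2, of "Im c" b] n1 n r2
        by (simp add: z distrib_left n_def[symmetric] power2_sum right_diff_distrib del: times_divide_eq_right times_divide_eq_left)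
           (simp add: n_def)
      finally show ?thesis using n circle by (intro exI[of _ "n / r\<^sup>2"]) simp
    qed
  qed
  ultimately show ?thesis using circle by simp
next
  case (line u p)
  then have "vrefl d = vrefl (line_vec p u)"
    using locus_eq_imp[of "line_vec p u" d] d by (auto simp: line_vec_unit locus_line_vec)
  moreover have "vrefl (line_vec p u) (pt x) = 1 *\<^sub>R pt (line_reflection p u x)"
  proof (cases x)
    case None
    then show ?thesis
      by (simp add: vrefl_def line_reflection_def line_vec_def zero_prod_def)
  next
    case (Some z)
    define m where "m = Im ((z - p) / u)"
    have m: "m * (cmod u)\<^sup>2 = Im (z - p) * Re u - Re (z - p) * Im u"
      using line by (simp add: m_def Im_divide cmod_power2)
    have mk: "mink (pt (Some z)) (line_vec p u) = cmod u * m"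
      using line by (simp add: mink_commute mink_line_vec m_def del: pt.simps)
    have "cnj q = q - 2 * \<i> * Im q" for q
      by (simp add: complex_eq_iff)
    then have cnj: "cnj ((z - p) / u) = (z - p) / u - 2 * \<i> * m"
      unfolding m_def .
    have "p + u * cnj ((z - p) / u) = z - 2 * \<i> * m * u"
      unfolding cnj using line by (simp add: field_simps)
    then have s: "line_reflection p u x = Some (z - 2 * \<i> * m * u)"
      by (simp add: line_reflection_def Some)
    have "(Re z + 2 * m * Im u)\<^sup>2 + (Im z - 2 * m * Re u)\<^sup>2 =
        (Re z)\<^sup>2 + (Im z)\<^sup>2 + 4 * m * (Re z * Im u - Im z * Re u + m * (cmod u)\<^sup>2)"
      unfolding cmod_power2 by (simp add: power2_eq_square algebra_simps)
    also have "Re z * Im u - Im z * Re u + m * (cmod u)\<^sup>2 = Re p * Im u - Im p * Re u"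
      unfolding m by (simp add: algebra_simps)
    finally show ?thesis
      unfolding s unfolding vrefl_def Some mk using line(3)
      by (simp add: line_vec_def algebra_simps diff_divide_distrib)
  qed
  ultimately show ?thesis using line by (metis zero_less_one)
qed

lemma inversion_invol:
  assumes "inversion_in D s"
  shows "s (s x) = x"
  using assms
proof cases
  case (circle r c)
  then show ?thesis
    by (cases x) (auto simp: circ_inversion_def)
next
  case (line u p)
  then show ?thesis
    by (cases x) (auto simp: line_reflection_def)
qed

text \<open>The reflection preserves \<open>mink\<close>, and the scalar does not affect vanishing,
  so incidence is carried over; involutivity gives the reverse inclusion.\<close>

lemma inversion_image_locus:
  assumes "inversion_in D s" "mink d d = 1" "locus d = D"
  shows "s ` locus u = locus (vrefl d u)"
proof -
  have iff: "x \<in> locus u \<longleftrightarrow> s x \<in> locus (vrefl d u)" for x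
  proof -
    obtain t where "t > 0" "vrefl d (pt x) = t *\<^sub>R pt (s x)"
      using inversion_pt[OF assms] by blast
    with mink_vrefl[OF assms(2), of u "pt x"] show ?thesis
      by (auto simp: locus_def mink_linear)
  qed
  show ?thesis
  proof
    show "s ` locus u \<subseteq> locus (vrefl d u)" using iff by auto
    show "locus (vrefl d u) \<subseteq> s ` locus u"
    proof
      fix y assume "y \<in> locus (vrefl d u)"
      with iff[of "s y"] inversion_invol[OF assms(1), of y] show "y \<in> s ` locus u"
        by (metis imageI)
    qed
  qed
qed

section \<open>Rigidity of cubic configurations\<close>

text \<open>A single linear map of the coefficient tuple, so that in dimension four injectivity
  yields surjectivity.\<close>

definition comb :: "vec \<Rightarrow> vec \<Rightarrow> vec \<Rightarrow> vec \<Rightarrow> vec \<Rightarrow> vec" where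
  "comb v\<^sub>0 v\<^sub>1 v\<^sub>2 v\<^sub>3 = (\<lambda>(a, b, c, d). a *\<^sub>R v\<^sub>0 + b *\<^sub>R v\<^sub>1 + c *\<^sub>R v\<^sub>2 + d *\<^sub>R v\<^sub>3)"

lemma linear_comb: "linear (comb v\<^sub>0 v\<^sub>1 v\<^sub>2 v\<^sub>3)"
  by (rule linearI) (auto simp: comb_def algebra_simps)

definition frame :: "vec \<Rightarrow> vec \<Rightarrow> vec \<Rightarrow> vec \<Rightarrow> bool" where
  "frame W E\<^sub>1 E\<^sub>2 E\<^sub>3 \<longleftrightarrow> mink W W = - 2 \<and> mink E\<^sub>1 E\<^sub>1 = 1 \<and> mink E\<^sub>2 E\<^sub>2 = 1 \<and> mink E\<^sub>3 E\<^sub>3 = 1 \<and>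
     mink W E\<^sub>1 = 0 \<and> mink W E\<^sub>2 = 0 \<and> mink W E\<^sub>3 = 0 \<and>
     mink E\<^sub>1 E\<^sub>2 = 0 \<and> mink E\<^sub>1 E\<^sub>3 = 0 \<and> mink E\<^sub>2 E\<^sub>3 = 0"

lemma frame_mink:
  assumes "frame W E\<^sub>1 E\<^sub>2 E\<^sub>3"
  shows "mink (comb W E\<^sub>1 E\<^sub>2 E\<^sub>3 (a, b, c, d)) (comb W E\<^sub>1 E\<^sub>2 E\<^sub>3 (a', b', c', d')) =
    - 2 * a * a' + b * b' + c * c' + d * d'"
  using assms unfolding frame_def comb_def
  by (simp add: mink_linear mink_commute[of E\<^sub>1 W] mink_commute[of E\<^sub>2 W] mink_commute[of E\<^sub>3 W]
      mink_commute[of E\<^sub>2 E\<^sub>1] mink_commute[of E\<^sub>3 E\<^sub>1] mink_commute[of E\<^sub>3 E\<^sub>2])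

text \<open>Pairing with the frame recovers the coefficients, so \<open>comb\<close> is injective
  and hence onto.\<close>

lemma frame_expansion:
  assumes "frame W E\<^sub>1 E\<^sub>2 E\<^sub>3"
  shows "u = comb W E\<^sub>1 E\<^sub>2 E\<^sub>3 (- mink u W / 2, mink u E\<^sub>1, mink u E\<^sub>2, mink u E\<^sub>3)"
proof -
  let ?f = "comb W E\<^sub>1 E\<^sub>2 E\<^sub>3"
  have coord: "mink (?f (a, b, c, d)) W = - 2 * a \<and> mink (?f (a, b, c, d)) E\<^sub>1 = b \<and>
      mink (?f (a, b, c, d)) E\<^sub>2 = c \<and> mink (?f (a, b, c, d)) E\<^sub>3 = d" for a b c d
    using frame_mink[OF assms, of a b c d 1 0 0 0] frame_mink[OF assms, of a b c d 0 1 0 0]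
      frame_mink[OF assms, of a b c d 0 0 1 0] frame_mink[OF assms, of a b c d 0 0 0 1]
    by (simp add: comb_def)
  have "q = q'" if "?f q = ?f q'" for q q'
  proof -
    obtain a b c d where q: "q = (a, b, c, d)" by (cases q)
    obtain a' b' c' d' where q': "q' = (a', b', c', d')" by (cases q')
    show ?thesis
      using coord[of a b c d] coord[of a' b' c' d'] unfolding that[unfolded q q'] by (auto simp: q q')
  qed
  then have "inj ?f" by (auto simp: inj_def)
  then have "surj ?f" using linear_injective_imp_surjective linear_comb by blast
  then obtain q where "u = ?f q" by (metis surjD)
  moreover obtain a b c d where "q = (a, b, c, d)" by (cases q)
  ultimately show ?thesis using coord[of a b c d] by simp
qed

text \<open>The product with the point at infinity is minus half the curvature. Expanding this null
  vector in the frame turns its vanishing norm into a Descartes-type relation among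
  curvatures.\<close>

lemma frame_null:
  assumes f: "frame W E\<^sub>1 E\<^sub>2 E\<^sub>3"
  shows "(fst W)\<^sup>2 = 2 * ((fst E\<^sub>1)\<^sup>2 + (fst E\<^sub>2)\<^sup>2 + (fst E\<^sub>3)\<^sup>2)"
proof -
  let ?n = "pt None"
  have fst: "mink ?n u = - fst u / 2" for u by (cases u) simp
  have "mink ?n ?n = 0" by simp
  then have "- 2 * (- mink ?n W / 2) * (- mink ?n W / 2) + mink ?n E\<^sub>1 * mink ?n E\<^sub>1
      + mink ?n E\<^sub>2 * mink ?n E\<^sub>2 + mink ?n E\<^sub>3 * mink ?n E\<^sub>3 = 0"
    using frame_mink[OF f] frame_expansion[OF f, of ?n] by metis
  then show ?thesis unfolding fst by (simp add: power2_eq_square)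
qed

text \<open>By nondegeneracy the vectors orthogonal to \<open>d\<close> do not fill the space, so
  four of them cannot be independent.\<close>

lemma orthogonal_imp_dependent:
  assumes "d \<noteq> 0" "mink d v\<^sub>0 = 0" "mink d v\<^sub>1 = 0" "mink d v\<^sub>2 = 0" "mink d v\<^sub>3 = 0"
  obtains q where "q \<noteq> 0" "comb v\<^sub>0 v\<^sub>1 v\<^sub>2 v\<^sub>3 q = 0"
proof -
  let ?f = "comb v\<^sub>0 v\<^sub>1 v\<^sub>2 v\<^sub>3"
  have "\<not> surj ?f"
  proof
    assume "surj ?f"
    have "mink d (?f q) = 0" for q
      using assms by (cases q) (simp add: comb_def mink_linear)
    with \<open>surj ?f\<close> have "mink d v = 0" for v by (metis surjD)
    then have "d = 0" by (rule mink_nondegenerate)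
    with \<open>d \<noteq> 0\<close> show False ..
  qed
  then have "\<not> inj ?f" using linear_injective_imp_surjective linear_comb by blast
  with that show ?thesis using linear_injective_0[OF linear_comb] by metis
qed

text \<open>A closed chain of four circles orthogonal to a common circle still has one free
  parameter \<open>\<mu>\<close>.\<close>

lemma orthogonal_face:
  assumes unit: "mink v\<^sub>1 v\<^sub>1 = 1" "mink v\<^sub>2 v\<^sub>2 = 1" "mink v\<^sub>3 v\<^sub>3 = 1" "mink v\<^sub>4 v\<^sub>4 = 1"
    and adj: "mink v\<^sub>1 v\<^sub>2 = - 1" "mink v\<^sub>2 v\<^sub>3 = - 1" "mink v\<^sub>3 v\<^sub>4 = - 1" "mink v\<^sub>1 v\<^sub>4 = - 1"
    and opp: "mink v\<^sub>1 v\<^sub>3 < - 1" "mink v\<^sub>2 v\<^sub>4 < - 1"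
    and orth: "d \<noteq> 0" "mink d v\<^sub>1 = 0" "mink d v\<^sub>2 = 0" "mink d v\<^sub>3 = 0" "mink d v\<^sub>4 = 0"
  obtains \<mu> where "\<mu> > 0" "v\<^sub>1 + v\<^sub>3 = \<mu> *\<^sub>R (v\<^sub>2 + v\<^sub>4)"
proof -
  obtain q where "q \<noteq> 0" and q0: "comb v\<^sub>1 v\<^sub>2 v\<^sub>3 v\<^sub>4 q = 0"
    using orthogonal_imp_dependent[OF orth] by blast
  obtain c\<^sub>1 c\<^sub>2 c\<^sub>3 c\<^sub>4 where q: "q = (c\<^sub>1, c\<^sub>2, c\<^sub>3, c\<^sub>4)" by (cases q)
  have 0: "c\<^sub>1 *\<^sub>R v\<^sub>1 + c\<^sub>2 *\<^sub>R v\<^sub>2 + c\<^sub>3 *\<^sub>R v\<^sub>3 + c\<^sub>4 *\<^sub>R v\<^sub>4 = 0"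
    using q0 by (simp add: q comb_def)
  note sym = mink_commute[of v\<^sub>2 v\<^sub>1] mink_commute[of v\<^sub>3 v\<^sub>1] mink_commute[of v\<^sub>4 v\<^sub>1]
    mink_commute[of v\<^sub>3 v\<^sub>2] mink_commute[of v\<^sub>4 v\<^sub>2] mink_commute[of v\<^sub>4 v\<^sub>3]
  have "mink (c\<^sub>1 *\<^sub>R v\<^sub>1 + c\<^sub>2 *\<^sub>R v\<^sub>2 + c\<^sub>3 *\<^sub>R v\<^sub>3 + c\<^sub>4 *\<^sub>R v\<^sub>4) v = 0" for v
    unfolding 0 by simp
  from this[of v\<^sub>1] this[of v\<^sub>2] this[of v\<^sub>3] this[of v\<^sub>4]
  have e: "c\<^sub>1 - c\<^sub>2 + c\<^sub>3 * mink v\<^sub>1 v\<^sub>3 - c\<^sub>4 = 0" "- c\<^sub>1 + c\<^sub>2 - c\<^sub>3 + c\<^sub>4 * mink v\<^sub>2 v\<^sub>4 = 0"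
    "c\<^sub>1 * mink v\<^sub>1 v\<^sub>3 - c\<^sub>2 + c\<^sub>3 - c\<^sub>4 = 0" "- c\<^sub>1 + c\<^sub>2 * mink v\<^sub>2 v\<^sub>4 - c\<^sub>3 + c\<^sub>4 = 0"
    by (simp_all add: mink_linear unit adj sym)
  \<comment> \<open>Subtracting the equations of opposite vertices compares the coefficients on each
    diagonal; the second factors are positive since opposite products are below -1.\<close>
  have "(c\<^sub>1 - c\<^sub>3) * (1 - mink v\<^sub>1 v\<^sub>3) = 0" "(c\<^sub>2 - c\<^sub>4) * (1 - mink v\<^sub>2 v\<^sub>4) = 0"
    using e by (simp_all add: algebra_simps)
  then have c: "c\<^sub>3 = c\<^sub>1" "c\<^sub>4 = c\<^sub>2" using opp by auto
  have c2: "2 * c\<^sub>2 = c\<^sub>1 * (1 + mink v\<^sub>1 v\<^sub>3)" using e(1) by (simp add: c algebra_simps)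
  have "c\<^sub>1 \<noteq> 0" using \<open>q \<noteq> 0\<close> c2 by (auto simp: q c zero_prod_def)
  define \<mu> where "\<mu> = - (1 + mink v\<^sub>1 v\<^sub>3) / 2"
  have "c\<^sub>1 *\<^sub>R (v\<^sub>1 + v\<^sub>3) = c\<^sub>1 *\<^sub>R (\<mu> *\<^sub>R (v\<^sub>2 + v\<^sub>4))"
  proof -
    have "c\<^sub>1 * \<mu> = - c\<^sub>2" using c2 by (simp add: \<mu>_def algebra_simps)
    moreover have "c\<^sub>1 *\<^sub>R (v\<^sub>1 + v\<^sub>3) = (- c\<^sub>2) *\<^sub>R (v\<^sub>2 + v\<^sub>4)"
      unfolding scaleR_minus_left eq_neg_iff_add_eq_0 using 0 by (simp add: c algebra_simps)
    ultimately show ?thesis by simp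
  qed
  with \<open>c\<^sub>1 \<noteq> 0\<close> have "v\<^sub>1 + v\<^sub>3 = \<mu> *\<^sub>R (v\<^sub>2 + v\<^sub>4)" by (simp only: scaleR_cancel_left) simp
  moreover have "\<mu> > 0" using opp by (simp add: \<mu>_def)
  ultimately show ?thesis using that by blast
qed

text \<open>Equating the two expressions for \<open>g\<close> at each index and summing gives M (1 +
  N) = N (1 + M), so M = N and each \<mu> equals its \<nu>. The differences of the first three
  equations then factor with a positive cofactor.\<close>

lemma corner_parameters_eq:
  fixes \<mu>\<^sub>1 \<mu>\<^sub>2 \<mu>\<^sub>3 \<nu>\<^sub>1 \<nu>\<^sub>2 \<nu>\<^sub>3 g :: real
  assumes pos: "\<mu>\<^sub>1 > 0" "\<mu>\<^sub>2 > 0" "\<mu>\<^sub>3 > 0" "\<nu>\<^sub>1 > 0" "\<nu>\<^sub>2 > 0" "\<nu>\<^sub>3 > 0"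
    and eq: "\<mu>\<^sub>1 * (1 + \<nu>\<^sub>2 + \<nu>\<^sub>3) = g" "\<mu>\<^sub>2 * (1 + \<nu>\<^sub>1 + \<nu>\<^sub>3) = g" "\<mu>\<^sub>3 * (1 + \<nu>\<^sub>1 + \<nu>\<^sub>2) = g"
      "\<nu>\<^sub>1 * (1 + \<mu>\<^sub>2 + \<mu>\<^sub>3) = g" "\<nu>\<^sub>2 * (1 + \<mu>\<^sub>1 + \<mu>\<^sub>3) = g" "\<nu>\<^sub>3 * (1 + \<mu>\<^sub>1 + \<mu>\<^sub>2) = g"
  shows "\<mu>\<^sub>2 = \<mu>\<^sub>1 \<and> \<mu>\<^sub>3 = \<mu>\<^sub>1 \<and> \<nu>\<^sub>1 = \<mu>\<^sub>1 \<and> \<nu>\<^sub>2 = \<mu>\<^sub>1 \<and> \<nu>\<^sub>3 = \<mu>\<^sub>1"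
proof -
  define M where "M = \<mu>\<^sub>1 + \<mu>\<^sub>2 + \<mu>\<^sub>3"
  define N where "N = \<nu>\<^sub>1 + \<nu>\<^sub>2 + \<nu>\<^sub>3"
  have pq: "\<mu>\<^sub>1 * (1 + N) = \<nu>\<^sub>1 * (1 + M)" "\<mu>\<^sub>2 * (1 + N) = \<nu>\<^sub>2 * (1 + M)" "\<mu>\<^sub>3 * (1 + N) = \<nu>\<^sub>3 * (1 + M)"
    using eq by (simp_all add: M_def N_def algebra_simps)
  then have "M * (1 + N) = N * (1 + M)" by (simp add: M_def N_def distrib_right)
  then have "N = M" by (simp add: algebra_simps)
  moreover have "1 + M > 0" using pos by (simp add: M_def)
  ultimately have nu: "\<nu>\<^sub>1 = \<mu>\<^sub>1" "\<nu>\<^sub>2 = \<mu>\<^sub>2" "\<nu>\<^sub>3 = \<mu>\<^sub>3" using pq by auto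
  have "(\<mu>\<^sub>1 - \<mu>\<^sub>2) * (1 + \<mu>\<^sub>3) = 0" "(\<mu>\<^sub>1 - \<mu>\<^sub>3) * (1 + \<mu>\<^sub>2) = 0"
    using eq(1-3) unfolding nu by (simp_all add: algebra_simps)
  with pos nu show ?thesis by auto
qed

text \<open>Each face relation at one of the antipodal corners \<open>a\<^sub>0\<close>,
  \<open>b\<^sub>0\<close> is paired with the other corner; the product of the two corners is the
  shared constant behind \<open>?g\<close>.\<close>

lemma corner_rigid:
  assumes ab: "mink a\<^sub>0 b\<^sub>1 = - 1" "mink a\<^sub>0 b\<^sub>2 = - 1" "mink a\<^sub>0 b\<^sub>3 = - 1"
      "mink b\<^sub>0 a\<^sub>1 = - 1" "mink b\<^sub>0 a\<^sub>2 = - 1" "mink b\<^sub>0 a\<^sub>3 = - 1"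
    and unit: "mink a\<^sub>0 a\<^sub>0 = 1" "mink b\<^sub>0 b\<^sub>0 = 1"
    and pos: "\<mu>\<^sub>1 > 0" "\<mu>\<^sub>2 > 0" "\<mu>\<^sub>3 > 0" "\<nu>\<^sub>1 > 0" "\<nu>\<^sub>2 > 0" "\<nu>\<^sub>3 > 0"
    and face: "a\<^sub>0 + a\<^sub>1 = \<mu>\<^sub>1 *\<^sub>R (b\<^sub>2 + b\<^sub>3)" "a\<^sub>0 + a\<^sub>2 = \<mu>\<^sub>2 *\<^sub>R (b\<^sub>1 + b\<^sub>3)"
      "a\<^sub>0 + a\<^sub>3 = \<mu>\<^sub>3 *\<^sub>R (b\<^sub>1 + b\<^sub>2)" "b\<^sub>0 + b\<^sub>1 = \<nu>\<^sub>1 *\<^sub>R (a\<^sub>2 + a\<^sub>3)"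
      "b\<^sub>0 + b\<^sub>2 = \<nu>\<^sub>2 *\<^sub>R (a\<^sub>1 + a\<^sub>3)" "b\<^sub>0 + b\<^sub>3 = \<nu>\<^sub>3 *\<^sub>R (a\<^sub>1 + a\<^sub>2)"
  shows "\<mu>\<^sub>2 = \<mu>\<^sub>1 \<and> \<mu>\<^sub>3 = \<mu>\<^sub>1 \<and> \<nu>\<^sub>1 = \<mu>\<^sub>1 \<and> \<nu>\<^sub>2 = \<mu>\<^sub>1 \<and> \<nu>\<^sub>3 = \<mu>\<^sub>1"
proof -
  note m = arg_cong[of _ _ "\<lambda>x. mink a\<^sub>0 x"] arg_cong[of _ _ "\<lambda>x. mink b\<^sub>0 x"]
  have a: "mink a\<^sub>0 a\<^sub>1 = - 1 - 2 * \<mu>\<^sub>1" "mink a\<^sub>0 a\<^sub>2 = - 1 - 2 * \<mu>\<^sub>2" "mink a\<^sub>0 a\<^sub>3 = - 1 - 2 * \<mu>\<^sub>3"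
    using face(1-3)[THEN m(1)] by (simp_all add: mink_linear ab unit)
  have b: "mink b\<^sub>0 b\<^sub>1 = - 1 - 2 * \<nu>\<^sub>1" "mink b\<^sub>0 b\<^sub>2 = - 1 - 2 * \<nu>\<^sub>2" "mink b\<^sub>0 b\<^sub>3 = - 1 - 2 * \<nu>\<^sub>3"
    using face(4-6)[THEN m(2)] by (simp_all add: mink_linear ab unit)
  let ?g = "(1 - mink a\<^sub>0 b\<^sub>0) / 2"
  have ba: "mink b\<^sub>0 a\<^sub>0 = mink a\<^sub>0 b\<^sub>0" by (rule mink_commute)
  have "\<mu> * (1 + \<nu> + \<nu>') = ?g"
    if "a\<^sub>0 + a = \<mu> *\<^sub>R (b + b')" "mink b\<^sub>0 a = - 1" "mink b\<^sub>0 b = - 1 - 2 * \<nu>" "mink b\<^sub>0 b' = - 1 - 2 * \<nu>'"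
    for a b b' \<mu> \<nu> \<nu>'
    using that(1)[THEN m(2)] unfolding mink_linear that(2-) ba by (simp add: algebra_simps)
  note \<mu> = this[OF face(1) ab(4) b(2,3)] this[OF face(2) ab(5) b(1,3)] this[OF face(3) ab(6) b(1,2)]
  have "\<nu> * (1 + \<mu> + \<mu>') = ?g"
    if "b\<^sub>0 + b = \<nu> *\<^sub>R (a + a')" "mink a\<^sub>0 b = - 1" "mink a\<^sub>0 a = - 1 - 2 * \<mu>" "mink a\<^sub>0 a' = - 1 - 2 * \<mu>'"
    for b a a' \<mu> \<mu>' \<nu>
    using that(1)[THEN m(1)] unfolding mink_linear that(2-) by (simp add: algebra_simps)
  note \<nu> = this[OF face(4) ab(1) a(2,3)] this[OF face(5) ab(2) a(1,3)] this[OF face(6) ab(3) a(1,2)]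
  show ?thesis by (rule corner_parameters_eq[OF pos \<mu> \<nu>])
qed

section \<open>From one corner to the whole cube\<close>

definition sgb :: "bool \<Rightarrow> int" where
  "sgb b = (if b then 1 else - 1)"

lemma sgb_simps [simp]: "sgb True = 1" "sgb False = - 1"
  by (simp_all add: sgb_def)

lemma cube_faces_intros:
  "{b} \<times> UNIV \<times> UNIV \<in> cube_faces" "UNIV \<times> {b} \<times> UNIV \<in> cube_faces"
  "UNIV \<times> UNIV \<times> {b} \<in> cube_faces"
  unfolding cube_faces_def by (rule UN_I[of b]; simp)+

lemma cube_rigid:
  fixes U :: "cube_vertex \<Rightarrow> vec"
  assumes unit: "\<And>v. mink (U v) (U v) = 1"
    and adj: "\<And>v w. cube_adj v w \<Longrightarrow> mink (U v) (U w) = - 1"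
    and nonadj: "\<And>v w. v \<noteq> w \<Longrightarrow> \<not> cube_adj v w \<Longrightarrow> mink (U v) (U w) < - 1"
    and dual: "\<And>F. F \<in> cube_faces \<Longrightarrow> \<exists>d. d \<noteq> 0 \<and> (\<forall>v\<in>F. mink d (U v) = 0)"
  obtains W E\<^sub>1 E\<^sub>2 E\<^sub>3 where "frame W E\<^sub>1 E\<^sub>2 E\<^sub>3"
    "\<And>x y z. U (x, y, z) = comb W E\<^sub>1 E\<^sub>2 E\<^sub>3 (1, sgb x, sgb y, sgb z)"
    "2 *\<^sub>R W = U (False, False, False) + U (True, True, True)"
proof -
  have face: "\<exists>\<mu> > 0. U v\<^sub>1 + U v\<^sub>3 = \<mu> *\<^sub>R (U v\<^sub>2 + U v\<^sub>4)"
    if F: "{v\<^sub>1, v\<^sub>2, v\<^sub>3, v\<^sub>4} \<in> cube_faces" and adjs: "cube_adj v\<^sub>1 v\<^sub>2" "cube_adj v\<^sub>2 v\<^sub>3" "cube_adj v\<^sub>3 v\<^sub>4" "cube_adj v\<^sub>1 v\<^sub>4"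
      and nadjs: "v\<^sub>1 \<noteq> v\<^sub>3" "\<not> cube_adj v\<^sub>1 v\<^sub>3" "v\<^sub>2 \<noteq> v\<^sub>4" "\<not> cube_adj v\<^sub>2 v\<^sub>4" for v\<^sub>1 v\<^sub>2 v\<^sub>3 v\<^sub>4
  proof -
    obtain d where "d \<noteq> 0" "\<forall>v\<in>{v\<^sub>1, v\<^sub>2, v\<^sub>3, v\<^sub>4}. mink d (U v) = 0"
      using dual[OF F] by blast
    then have "d \<noteq> 0" "mink d (U v\<^sub>1) = 0" "mink d (U v\<^sub>2) = 0" "mink d (U v\<^sub>3) = 0" "mink d (U v\<^sub>4) = 0"
      by simp_all
    then show ?thesis
      using orthogonal_face[OF unit unit unit unit adj[OF adjs(1)] adj[OF adjs(2)] adj[OF adjs(3)]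
          adj[OF adjs(4)] nonadj[OF nadjs(1,2)] nonadj[OF nadjs(3,4)]] by blast
  qed
  \<comment> \<open>The \<open>a\<close> and the \<open>b\<close> are the two colour classes of the
    cube; equal indices mark antipodal vertices.\<close>
  define a\<^sub>0 where "a\<^sub>0 = U (False, False, False)"
  define a\<^sub>1 where "a\<^sub>1 = U (False, True, True)"
  define a\<^sub>2 where "a\<^sub>2 = U (True, False, True)"
  define a\<^sub>3 where "a\<^sub>3 = U (True, True, False)"
  define b\<^sub>0 where "b\<^sub>0 = U (True, True, True)"
  define b\<^sub>1 where "b\<^sub>1 = U (True, False, False)"
  define b\<^sub>2 where "b\<^sub>2 = U (False, True, False)"
  define b\<^sub>3 where "b\<^sub>3 = U (False, False, True)"
  note defs = a\<^sub>0_def a\<^sub>1_def a\<^sub>2_def a\<^sub>3_def b\<^sub>0_def b\<^sub>1_def b\<^sub>2_def b\<^sub>3_def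
  have F: "{False} \<times> UNIV \<times> UNIV = {(False, False, False), (False, True, False), (False, True, True), (False, False, True)}"
    "UNIV \<times> {False} \<times> UNIV = {(False, False, False), (True, False, False), (True, False, True), (False, False, True)}"
    "UNIV \<times> UNIV \<times> {False} = {(False, False, False), (True, False, False), (True, True, False), (False, True, False)}"
    "{True} \<times> UNIV \<times> UNIV = {(True, True, True), (True, False, True), (True, False, False), (True, True, False)}"
    "UNIV \<times> {True} \<times> UNIV = {(True, True, True), (False, True, True), (False, True, False), (True, True, False)}"
    "UNIV \<times> UNIV \<times> {True} = {(True, True, True), (False, True, True), (False, False, True), (True, False, True)}"
    by (auto simp: UNIV_bool)
  have faces: "{False} \<times> UNIV \<times> UNIV \<in> cube_faces" "UNIV \<times> {False} \<times> UNIV \<in> cube_faces"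
    "UNIV \<times> UNIV \<times> {False} \<in> cube_faces" "{True} \<times> UNIV \<times> UNIV \<in> cube_faces"
    "UNIV \<times> {True} \<times> UNIV \<in> cube_faces" "UNIV \<times> UNIV \<times> {True} \<in> cube_faces"
    by (rule cube_faces_intros)+
  obtain \<mu>\<^sub>1 where 1: "\<mu>\<^sub>1 > 0" "a\<^sub>0 + a\<^sub>1 = \<mu>\<^sub>1 *\<^sub>R (b\<^sub>2 + b\<^sub>3)"
    using face[OF faces(1)[unfolded F]] by (auto simp: defs)
  obtain \<mu>\<^sub>2 where 2: "\<mu>\<^sub>2 > 0" "a\<^sub>0 + a\<^sub>2 = \<mu>\<^sub>2 *\<^sub>R (b\<^sub>1 + b\<^sub>3)"
    using face[OF faces(2)[unfolded F]] by (auto simp: defs)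
  obtain \<mu>\<^sub>3 where 3: "\<mu>\<^sub>3 > 0" "a\<^sub>0 + a\<^sub>3 = \<mu>\<^sub>3 *\<^sub>R (b\<^sub>1 + b\<^sub>2)"
    using face[OF faces(3)[unfolded F]] by (auto simp: defs)
  obtain \<nu>\<^sub>1 where 4: "\<nu>\<^sub>1 > 0" "b\<^sub>0 + b\<^sub>1 = \<nu>\<^sub>1 *\<^sub>R (a\<^sub>2 + a\<^sub>3)"
    using face[OF faces(4)[unfolded F]] by (auto simp: defs)
  obtain \<nu>\<^sub>2 where 5: "\<nu>\<^sub>2 > 0" "b\<^sub>0 + b\<^sub>2 = \<nu>\<^sub>2 *\<^sub>R (a\<^sub>1 + a\<^sub>3)"
    using face[OF faces(5)[unfolded F]] by (auto simp: defs)
  obtain \<nu>\<^sub>3 where 6: "\<nu>\<^sub>3 > 0" "b\<^sub>0 + b\<^sub>3 = \<nu>\<^sub>3 *\<^sub>R (a\<^sub>1 + a\<^sub>2)"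
    using face[OF faces(6)[unfolded F]] by (auto simp: defs)
  have units: "mink a\<^sub>0 a\<^sub>0 = 1" "mink a\<^sub>1 a\<^sub>1 = 1" "mink b\<^sub>0 b\<^sub>0 = 1" "mink b\<^sub>1 b\<^sub>1 = 1" "mink b\<^sub>2 b\<^sub>2 = 1" "mink b\<^sub>3 b\<^sub>3 = 1"
    by (simp_all add: unit defs)
  have ab: "mink a\<^sub>0 b\<^sub>1 = - 1" "mink a\<^sub>0 b\<^sub>2 = - 1" "mink a\<^sub>0 b\<^sub>3 = - 1"
    "mink b\<^sub>0 a\<^sub>1 = - 1" "mink b\<^sub>0 a\<^sub>2 = - 1" "mink b\<^sub>0 a\<^sub>3 = - 1"
    "mink a\<^sub>1 b\<^sub>0 = - 1" "mink a\<^sub>1 b\<^sub>2 = - 1" "mink a\<^sub>1 b\<^sub>3 = - 1"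
    "mink b\<^sub>1 a\<^sub>0 = - 1" "mink b\<^sub>1 a\<^sub>2 = - 1" "mink b\<^sub>1 a\<^sub>3 = - 1" "mink a\<^sub>2 b\<^sub>1 = - 1"
    by (simp_all add: adj defs)
  have eq: "\<mu>\<^sub>2 = \<mu>\<^sub>1 \<and> \<mu>\<^sub>3 = \<mu>\<^sub>1 \<and> \<nu>\<^sub>1 = \<mu>\<^sub>1 \<and> \<nu>\<^sub>2 = \<mu>\<^sub>1 \<and> \<nu>\<^sub>3 = \<mu>\<^sub>1"
    by (rule corner_rigid[OF ab(1-6) units(1,3) 1(1) 2(1) 3(1) 4(1) 5(1) 6(1)
          1(2) 2(2) 3(2) 4(2) 5(2) 6(2)])
  have inv: "y = (1 / t) *\<^sub>R x" if "x = t *\<^sub>R y" "t > 0" for x y :: vec and t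
    using that by simp
  \<comment> \<open>Seen from the antipodal pair \<open>a\<^sub>1\<close>, \<open>b\<^sub>1\<close>,
    four faces have their diagonals interchanged, which inverts the parameter. So the common
    parameter is its own inverse.\<close>
  have "1 / \<nu>\<^sub>2 = \<mu>\<^sub>1"
  proof -
    have "a\<^sub>1 + a\<^sub>0 = \<mu>\<^sub>1 *\<^sub>R (b\<^sub>3 + b\<^sub>2)" "a\<^sub>1 + a\<^sub>3 = (1 / \<nu>\<^sub>2) *\<^sub>R (b\<^sub>0 + b\<^sub>2)"
      "a\<^sub>1 + a\<^sub>2 = (1 / \<nu>\<^sub>3) *\<^sub>R (b\<^sub>0 + b\<^sub>3)" "b\<^sub>1 + b\<^sub>0 = \<nu>\<^sub>1 *\<^sub>R (a\<^sub>3 + a\<^sub>2)"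
      "b\<^sub>1 + b\<^sub>3 = (1 / \<mu>\<^sub>2) *\<^sub>R (a\<^sub>0 + a\<^sub>2)" "b\<^sub>1 + b\<^sub>2 = (1 / \<mu>\<^sub>3) *\<^sub>R (a\<^sub>0 + a\<^sub>3)"
      using 1 4 inv[OF 5(2,1)] inv[OF 6(2,1)] inv[OF 2(2,1)] inv[OF 3(2,1)] by (simp_all add: add.commute)
    then show ?thesis
      using corner_rigid[of a\<^sub>1 b\<^sub>0 b\<^sub>3 b\<^sub>2 b\<^sub>1 a\<^sub>0 a\<^sub>3 a\<^sub>2 \<mu>\<^sub>1 "1 / \<nu>\<^sub>2" "1 / \<nu>\<^sub>3" \<nu>\<^sub>1 "1 / \<mu>\<^sub>2" "1 / \<mu>\<^sub>3"]
        ab units 1 2 3 4 5 6 by simp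
  qed
  then have "\<mu>\<^sub>1 * \<mu>\<^sub>1 = 1" using eq 1 by (auto simp: field_simps)
  then have m1: "\<mu>\<^sub>1 = 1" using 1 by (simp add: square_eq_1_iff)
  have a: "a\<^sub>1 = b\<^sub>2 + b\<^sub>3 - a\<^sub>0" "a\<^sub>2 = b\<^sub>1 + b\<^sub>3 - a\<^sub>0" "a\<^sub>3 = b\<^sub>1 + b\<^sub>2 - a\<^sub>0"
    using 1 2 3 eq m1 by (simp_all add: algebra_simps)
  have b: "b\<^sub>0 = b\<^sub>1 + b\<^sub>2 + b\<^sub>3 - 2 *\<^sub>R a\<^sub>0"
    using 4 eq m1 a by (simp add: algebra_simps scaleR_2)
  \<comment> \<open>With all parameters equal to 1 the face relations express the other vertices,
    and their tangencies determine the remaining products.\<close>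
  have bb: "mink b\<^sub>2 b\<^sub>3 = - 3" "mink b\<^sub>1 b\<^sub>3 = - 3" "mink b\<^sub>1 b\<^sub>2 = - 3"
    using ab(8,12,13) ab(1,2,3) units
    by (simp_all add: a mink_linear mink_commute[of b\<^sub>2 b\<^sub>1] mink_commute[of b\<^sub>3 b\<^sub>1] mink_commute[of b\<^sub>3 b\<^sub>2]
        mink_commute[of b\<^sub>1 a\<^sub>0])
  define W where "W = (1 / 2) *\<^sub>R (a\<^sub>0 + b\<^sub>0)"
  define E\<^sub>1 where "E\<^sub>1 = (1 / 2) *\<^sub>R (b\<^sub>1 - a\<^sub>0)"
  define E\<^sub>2 where "E\<^sub>2 = (1 / 2) *\<^sub>R (b\<^sub>2 - a\<^sub>0)"
  define E\<^sub>3 where "E\<^sub>3 = (1 / 2) *\<^sub>R (b\<^sub>3 - a\<^sub>0)"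
  have W: "W = (1 / 2) *\<^sub>R (b\<^sub>1 + b\<^sub>2 + b\<^sub>3 - a\<^sub>0)"
    by (simp add: W_def b scaleR_2)
  have fr: "frame W E\<^sub>1 E\<^sub>2 E\<^sub>3"
    using ab(1-3) units bb unfolding frame_def W E\<^sub>1_def E\<^sub>2_def E\<^sub>3_def
    by (simp add: mink_linear mink_commute[of b\<^sub>2 b\<^sub>1] mink_commute[of b\<^sub>3 b\<^sub>1] mink_commute[of b\<^sub>3 b\<^sub>2]
        mink_commute[of b\<^sub>1 a\<^sub>0] mink_commute[of b\<^sub>2 a\<^sub>0] mink_commute[of b\<^sub>3 a\<^sub>0])
  have half: "x = (1 / 2) *\<^sub>R y" if "x + x = y" for x y :: vec
    using that by (auto simp flip: scaleR_2)
  have "U (x, y, z) = comb W E\<^sub>1 E\<^sub>2 E\<^sub>3 (1, sgb x, sgb y, sgb z)" for x y z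
  proof -
    have "a\<^sub>0 = W - E\<^sub>1 - E\<^sub>2 - E\<^sub>3" "a\<^sub>1 = W - E\<^sub>1 + E\<^sub>2 + E\<^sub>3" "a\<^sub>2 = W + E\<^sub>1 - E\<^sub>2 + E\<^sub>3" "a\<^sub>3 = W + E\<^sub>1 + E\<^sub>2 - E\<^sub>3"
      "b\<^sub>0 = W + E\<^sub>1 + E\<^sub>2 + E\<^sub>3" "b\<^sub>1 = W + E\<^sub>1 - E\<^sub>2 - E\<^sub>3" "b\<^sub>2 = W - E\<^sub>1 + E\<^sub>2 - E\<^sub>3" "b\<^sub>3 = W - E\<^sub>1 - E\<^sub>2 + E\<^sub>3"
      unfolding W E\<^sub>1_def E\<^sub>2_def E\<^sub>3_def a b
      by (simp_all only: scaleR_right_diff_distrib[symmetric] scaleR_right_distrib[symmetric])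
        (rule half; simp add: scaleR_2)+
    then show ?thesis
      by (cases x; cases y; cases z; simp add: comb_def defs)
  qed
  moreover have "2 *\<^sub>R W = U (False, False, False) + U (True, True, True)"
    by (simp add: W_def defs)
  ultimately show ?thesis using that[OF fr] by blast
qed

text \<open>Disjoint interiors bound all products by -1. A tangency point gives the reverse bound,
  while for non-adjacent circles equality would create a common point. So the orientations given by
  the interiors satisfy the hypotheses of \<open>cube_rigid\<close>.\<close>

lemma cubic_configuration_frame:
  assumes "cubic_configuration C"
  obtains W E\<^sub>1 E\<^sub>2 E\<^sub>3 where "frame W E\<^sub>1 E\<^sub>2 E\<^sub>3" "fst W > 0"
    "\<And>x y z. C (x, y, z) = locus (comb W E\<^sub>1 E\<^sub>2 E\<^sub>3 (1, sgb x, sgb y, sgb z))"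
proof -
  have "\<exists>I. (\<forall>v. side (C v) (I v)) \<and> (\<forall>v w. v \<noteq> w \<longrightarrow> I v \<inter> I w = {})"
    using assms unfolding cubic_configuration_def by (elim conjE)
  then obtain I where I: "\<And>v. side (C v) (I v)" "\<And>v w. v \<noteq> w \<Longrightarrow> I v \<inter> I w = {}"
    by blast
  have "\<exists>u. mink u u = 1 \<and> locus u = C v \<and> pos_side u = I v" for v
  proof -
    obtain u where "mink u u = 1" "locus u = C v" "pos_side u = I v"
      by (rule side_imp_vec[OF I(1)[of v]])
    then show ?thesis by blast
  qed
  then obtain U where U: "\<And>v. mink (U v) (U v) = 1" "\<And>v. locus (U v) = C v" "\<And>v. pos_side (U v) = I v"
    by metis
  have le: "mink (U v) (U w) \<le> - 1 \<and> fst (U v) + fst (U w) \<ge> 0" if "v \<noteq> w" for v w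
    using disjoint_pos_side[of "U v" "U w"] U I that by simp
  have "inj C" using assms by (simp add: cubic_configuration_def)
  have tan: "v \<noteq> w \<Longrightarrow> cube_adj v w \<Longrightarrow> tangent (C v) (C w)"
    and dis: "v \<noteq> w \<Longrightarrow> \<not> cube_adj v w \<Longrightarrow> C v \<inter> C w = {}" for v w
    using assms unfolding cubic_configuration_def by metis+
  have adj: "mink (U v) (U w) = - 1" if "cube_adj v w" for v w
  proof -
    have "\<not> cube_adj v v" by (cases v) simp
    with that have "v \<noteq> w" by auto
    from tan[OF this that] obtain p where "C v \<inter> C w = {p}" unfolding tangent_def by blast
    then have "p \<in> C v" "p \<in> C w" by auto
    then have "mink (U v) (U w) \<ge> - 1" using common_point_imp_ge[of "U v" "U w" p] U by simp
    with le[OF \<open>v \<noteq> w\<close>] show ?thesis by simp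
  qed
  have nonadj: "mink (U v) (U w) < - 1" if "v \<noteq> w" "\<not> cube_adj v w" for v w
  proof -
    have "U v + U w \<noteq> 0"
    proof
      assume "U v + U w = 0"
      then have "U w = - U v" by (simp add: eq_neg_iff_add_eq_0 add.commute)
      then have "C v = C w" using U(2) locus_minus by metis
      with \<open>inj C\<close> that show False by (simp add: inj_eq)
    qed
    then have "mink (U v) (U w) \<noteq> - 1"
      using mink_eq_minus_1_imp_tangent[of "U v" "U w"] U dis[OF that] by (auto simp: tangent_def)
    with le[OF that(1)] show ?thesis by simp
  qed
  have dual: "\<exists>d. d \<noteq> 0 \<and> (\<forall>v\<in>F. mink d (U v) = 0)" if F: "F \<in> cube_faces" for F
  proof -
    have "\<exists>D. dual_circle C F D" using assms F by (simp add: cubic_configuration_def)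
    then obtain D where D: "gen_circle D" "\<And>v. v \<in> F \<Longrightarrow> orthogonal_circles D (C v)"
      unfolding dual_circle_def by blast
    obtain d where d: "mink d d = 1" "locus d = D" using gen_circle_imp_vec[OF D(1)] .
    then have "\<forall>v\<in>F. mink d (U v) = 0" using D orthogonal_circles_imp U by blast
    moreover have "d \<noteq> 0" using d by auto
    ultimately show ?thesis by blast
  qed
  obtain W E\<^sub>1 E\<^sub>2 E\<^sub>3 where fr: "frame W E\<^sub>1 E\<^sub>2 E\<^sub>3"
    and UW: "\<And>x y z. U (x, y, z) = comb W E\<^sub>1 E\<^sub>2 E\<^sub>3 (1, sgb x, sgb y, sgb z)"
    and W: "2 *\<^sub>R W = U (False, False, False) + U (True, True, True)"
    using cube_rigid[of U, OF U(1) adj nonadj dual] by blast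
  \<comment> \<open>\<open>2 *\<^sub>R W\<close> is the sum of two opposite circles, whose
    curvatures add up to at least 0. The value 0 is impossible because a vector with first
    coordinate 0 has non-negative norm, while \<open>W\<close> has norm -2.\<close>
  have "fst W \<ge> 0"
    using le[of "(False, False, False)" "(True, True, True)"] arg_cong[OF W, of fst] by simp
  moreover have "fst W \<noteq> 0"
  proof
    assume "fst W = 0"
    moreover obtain k h x y where "W = (k, h, x, y)" by (cases W)
    moreover have "x * x + y * y \<ge> 0" for x y :: real by simp
    ultimately show False using fr by (simp add: frame_def) (metis add_nonneg_nonneg zero_le_square neg_0_le_iff_le not_numeral_le_zero)
  qed
  ultimately have "fst W > 0" by simp
  then show ?thesis using that[OF fr] U(2) UW by metis
qed

section \<open>The reflection group in integral coordinates\<close>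

type_synonym quad = "int \<times> int \<times> int \<times> int"

definition form :: "quad \<Rightarrow> quad \<Rightarrow> int" where
  "form p q = (case p of (a, b, c, d) \<Rightarrow> case q of (a', b', c', d') \<Rightarrow>
     - 2 * a * a' + b * b' + c * c' + d * d')"

lemma form_coords [simp]:
  "form (a, b, c, d) (a', b', c', d') = - 2 * a * a' + b * b' + c * c' + d * d'"
  by (simp add: form_def)

definition vertices :: "quad set" where
  "vertices = {(1, sgb x, sgb y, sgb z) |x y z. True}"

text \<open>\<open>(1, 2, 0, 0)\<close> is orthogonal to the four vertices with second coordinate 1,
  as -2 + 2 = 0. Its norm is -2 + 4 = 2, so the unit vector of the dual circle is this one divided
  by the square root of 2.\<close>

definition duals :: "quad set" where
  "duals = (\<Union>b. {(1, 2 * sgb b, 0, 0), (1, 0, 2 * sgb b, 0), (1, 0, 0, 2 * sgb b)})"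

text \<open>As \<open>form d d = 2\<close> for a dual, the usual factor 2 form(p, d) / form(d, d) is
  just \<open>form p d\<close>, and no denominators arise.\<close>

fun srefl :: "quad \<Rightarrow> quad \<Rightarrow> quad" where
  "srefl (\<delta>, \<delta>\<^sub>1, \<delta>\<^sub>2, \<delta>\<^sub>3) (a, b, c, d) =
     (let m = form (a, b, c, d) (\<delta>, \<delta>\<^sub>1, \<delta>\<^sub>2, \<delta>\<^sub>3)
      in (a - m * \<delta>, b - m * \<delta>\<^sub>1, c - m * \<delta>\<^sub>2, d - m * \<delta>\<^sub>3))"

lemma vertices_eq:
  "vertices = {(1, 1, 1, 1), (1, 1, 1, - 1), (1, 1, - 1, 1), (1, 1, - 1, - 1),
     (1, - 1, 1, 1), (1, - 1, 1, - 1), (1, - 1, - 1, 1), (1, - 1, - 1, - 1)}"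
  unfolding vertices_def sgb_def by (auto simp: ex_bool_eq)

lemma duals_eq:
  "duals = {(1, 2, 0, 0), (1, - 2, 0, 0), (1, 0, 2, 0), (1, 0, - 2, 0), (1, 0, 0, 2), (1, 0, 0, - 2)}"
  by (auto simp: duals_def UNIV_bool)

lemma form_commute: "form p q = form q p"
  by (cases p; cases q) simp

lemma form_srefl_left: "form (srefl d p) q = form p q - form p d * form d q"
  by (cases d; cases p; cases q) (simp add: Let_def algebra_simps)

lemma form_dual_dual:
  assumes "d \<in> duals"
  shows "form d d = 2"
  using assms by (auto simp: duals_eq)

text \<open>At norm 2, the value -2 is the normalised product -1: dual circles of adjacent faces are
  tangent, those of opposite faces disjoint.\<close>

lemma form_dual_dual_neq:
  assumes "d \<in> duals" "e \<in> duals" "d \<noteq> e"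
  shows "form d e \<le> - 2"
  using assms by (auto simp: duals_eq)

lemma form_vertex_dual:
  assumes "v \<in> vertices" "d \<in> duals"
  shows "form v d = 0 \<or> form v d = - 4"
  using assms unfolding vertices_eq duals_eq by auto

lemma form_vertex_vertex:
  assumes "v \<in> vertices" "w \<in> vertices"
  shows "v = w \<or> form v w \<le> - 1"
  using assms unfolding vertices_eq by auto

lemma form_vertex_self: "v \<in> vertices \<Longrightarrow> form v v = 1"
  unfolding vertices_eq by auto

lemma srefl_fix: "form p d = 0 \<Longrightarrow> srefl d p = p"
  by (cases d; cases p) (simp add: Let_def)

lemma form_srefl_right: "form p (srefl d q) = form p q - form q d * form p d"
  by (cases d; cases p; cases q) (simp add: Let_def algebra_simps)

lemma form_srefl: "d \<in> duals \<Longrightarrow> form (srefl d p) (srefl d q) = form p q"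
  unfolding form_srefl_left form_srefl_right form_commute[of d q]
  by (simp add: form_dual_dual)

lemma srefl_srefl: "d \<in> duals \<Longrightarrow> srefl d (srefl d p) = p"
  unfolding duals_eq by (cases p) (auto simp: Let_def)

text \<open>The vectors \<open>srefl d\<^sub>1 (\<dots> (srefl d\<^sub>n v))\<close> for reduced words, labelled with \<open>d\<^sub>1\<close>.\<close>

inductive reduced :: "quad \<Rightarrow> quad \<Rightarrow> bool" where
  base: "v \<in> vertices \<Longrightarrow> d \<in> duals \<Longrightarrow> form v d = - 4 \<Longrightarrow> reduced d (srefl d v)"
| step: "reduced e u \<Longrightarrow> d \<in> duals \<Longrightarrow> d \<noteq> e \<Longrightarrow> reduced d (srefl d u)"

text \<open>The third conjunct carries the induction: as distinct duals have product at most \<open>- 2\<close>, it is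
  inherited by the next reflection.\<close>

lemma reduced_bounds:
  assumes "reduced d u"
  shows "d \<in> duals \<and> form u d \<ge> 4 \<and> (\<forall>e\<in>duals - {d}. form u e \<le> - form u d - 4) \<and>
    (\<forall>v\<in>vertices. form u v \<le> - 1) \<and> fst u \<ge> 1"
  using assms
proof induction
  case (base v d)
  have "form (srefl d v) w \<le> - 1" if "w \<in> vertices" for w
    using form_vertex_vertex[OF base(1) that] form_vertex_dual[OF that base(2)]
      form_vertex_self[OF that] base(3) by (auto simp: form_srefl_left form_commute[of d])
  moreover have "form (srefl d v) e \<le> - form (srefl d v) d - 4" if "e \<in> duals" "e \<noteq> d" for e
    using form_dual_dual_neq[of d e] form_vertex_dual[OF base(1) that(1)] base that
    by (auto simp: form_srefl_left form_dual_dual)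
  moreover have "fst (srefl d v) \<ge> 1"
    using base unfolding vertices_eq duals_eq by (auto simp: Let_def)
  ultimately show ?case using base by (auto simp: form_srefl_left form_dual_dual)
next
  case (step e u d)
  have e: "e \<in> duals" and m': "form u e \<ge> 4" and m: "form u d \<le> - form u e - 4"
    using step by auto
  have d2: "form (srefl d u) d = - form u d"
    using step(2) by (simp add: form_srefl_left form_dual_dual)
  have "form (srefl d u) w \<le> - 1" if "w \<in> vertices" for w
  proof -
    have "form u w \<le> - 1" using step that by auto
    moreover have "form u d * form d w \<ge> 0"
      using m m' form_vertex_dual[OF that step(2)] by (auto simp: form_commute[of d])
    ultimately show ?thesis by (simp add: form_srefl_left)
  qed
  moreover have "form (srefl d u) f \<le> - form (srefl d u) d - 4" if "f \<in> duals" "f \<noteq> d" for f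
  proof -
    have "form u f \<le> form u e"
      using step.IH that m' by (cases "f = e") force+
    moreover have "form d f \<le> - 2" using form_dual_dual_neq step(2) that by blast
    then have "form u d * form d f \<ge> form u d * (- 2)"
      using m m' by (intro mult_left_mono_neg) auto
    ultimately show ?thesis using m by (simp add: form_srefl_left d2[unfolded form_srefl_left])
  qed
  moreover have "fst (srefl d u) \<ge> 1"
  proof -
    have "fst d = 1" using step(2) by (auto simp: duals_eq)
    then have "fst (srefl d u) = fst u - form u d"
      by (cases u; cases d) (simp add: Let_def)
    moreover have "fst u \<ge> 1" using step by auto
    ultimately show ?thesis using m m' by simp
  qed
  ultimately show ?case using step(2) m m' d2 by auto
qed

section \<open>The orbit of the vertices and its separation\<close>

definition orbit :: "quad set" where
  "orbit = vertices \<union> {u. \<exists>d. reduced d u}"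

lemma orbit_vertex: "v \<in> vertices \<Longrightarrow> v \<in> orbit"
  and orbit_reduced: "reduced d u \<Longrightarrow> u \<in> orbit"
  unfolding orbit_def by blast+

text \<open>A reflection fixes a vertex, starts or lengthens a reduced word, or cancels the leading
  letter of one.\<close>

lemma srefl_orbit:
  assumes "u \<in> orbit" "d \<in> duals"
  shows "srefl d u \<in> orbit"
proof (cases "u \<in> vertices")
  case True
  then show ?thesis
    using form_vertex_dual[OF True assms(2)] srefl_fix[of u d]
      orbit_reduced[OF reduced.base[OF True assms(2)]] by (auto simp: orbit_vertex)
next
  case False
  then obtain e where r: "reduced e u" using assms unfolding orbit_def by blast
  show ?thesis
  proof (cases "d = e")
    case False
    then show ?thesis using orbit_reduced[OF reduced.step[OF r assms(2)]] by simp
  next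
    case True
    show ?thesis
      using r
    proof cases
      case (base v)
      with True assms(2) show ?thesis by (simp add: srefl_srefl orbit_vertex)
    next
      case (step e' u')
      with True assms(2) show ?thesis by (simp add: srefl_srefl orbit_reduced)
    qed
  qed
qed

abbreviation act :: "quad list \<Rightarrow> quad \<Rightarrow> quad" where
  "act ws q \<equiv> foldr srefl ws q"

lemma act_orbit:
  assumes "set ws \<subseteq> duals" "v \<in> vertices"
  shows "act ws v \<in> orbit"
  using assms by (induction ws) (auto simp: srefl_orbit orbit_vertex)

lemma form_act: "set ws \<subseteq> duals \<Longrightarrow> form (act ws p) (act ws q) = form p q"
  by (induction ws) (auto simp: form_srefl)

lemma act_rev:
  assumes "set ws \<subseteq> duals"
  shows "act (rev ws) (act ws q) = q" "act ws (act (rev ws) q) = q"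
proof -
  have *: "act (rev ws) (act ws q) = q" if "set ws \<subseteq> duals" for ws q
    using that by (induction ws arbitrary: q) (auto simp: srefl_srefl)
  from *[of ws] *[of "rev ws"] assms show "act (rev ws) (act ws q) = q" "act ws (act (rev ws) q) = q"
    by simp_all
qed

text \<open>Undoing one of the two words reduces the claim to an orbit vector against a vertex,
  where the bounds for reduced words apply.\<close>

lemma act_vertices_separated:
  assumes "set ws \<subseteq> duals" "set ws' \<subseteq> duals" "v \<in> vertices" "w \<in> vertices"
  shows "act ws v = act ws' w \<or> form (act ws v) (act ws' w) \<le> - 1"
proof -
  let ?u = "act (rev ws' @ ws) v"
  have "?u \<in> orbit" using assms by (intro act_orbit) auto
  then consider "?u \<in> vertices" | d where "reduced d ?u" unfolding orbit_def by blast
  then have "?u = w \<or> form ?u w \<le> - 1"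
    using form_vertex_vertex[OF _ assms(4)] reduced_bounds assms(4) by cases blast+
  moreover have "act ws' ?u = act ws v" using act_rev(2)[OF assms(2)] by simp
  ultimately show ?thesis using form_act[OF assms(2), of ?u w] by metis
qed

lemma fst_act_pos:
  assumes "set ws \<subseteq> duals" "v \<in> vertices"
  shows "fst (act ws v) \<ge> 1"
proof -
  have "fst u \<ge> 1" if "u \<in> orbit" for u
    using that reduced_bounds[of _ u] by (auto simp: orbit_def vertices_eq)
  with act_orbit[OF assms] show ?thesis by blast
qed

text \<open>These are the integral combinations \<alpha> v + \<Sigma> n_i (v - v_i) of a vertex v
  and its three neighbours v_i, so four curvatures of one cube control the divisibility of all
  curvatures.\<close>

definition lattice :: "quad set" where
  "lattice = {(a, b, c, d). even (b - a) \<and> even (c - a) \<and> even (d - a)}"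

lemma srefl_lattice: "d \<in> duals \<Longrightarrow> q \<in> lattice \<Longrightarrow> srefl d q \<in> lattice"
  unfolding duals_eq lattice_def by (cases q) (auto simp: Let_def)

lemma act_lattice: "set ws \<subseteq> duals \<Longrightarrow> q \<in> lattice \<Longrightarrow> act ws q \<in> lattice"
  by (induction ws) (auto simp: srefl_lattice)

lemma vertices_lattice: "v \<in> vertices \<Longrightarrow> v \<in> lattice"
  by (auto simp: vertices_eq lattice_def)

text \<open>The neighbours of \<open>(1, \<epsilon>\<^sub>1, \<epsilon>\<^sub>2, \<epsilon>\<^sub>3)\<close> that also touch \<open>(1, - \<epsilon>\<^sub>1, \<epsilon>\<^sub>2, \<epsilon>\<^sub>3)\<close>. They are obtained from
  the two at \<open>k = 0, 1\<close> by reflecting alternately in the two faces through that edge.\<close>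

definition chain :: "bool \<times> bool \<times> bool \<Rightarrow> int \<Rightarrow> quad" where
  "chain = (\<lambda>(x, y, z) k. (2 * k\<^sup>2 - 2 * k + 1, sgb x, (2 * k\<^sup>2 - 1) * sgb y, (2 * k\<^sup>2 - 4 * k + 1) * sgb z))"

text \<open>On the index the reflections are \<open>2 - k\<close> and \<open>- k\<close>, so their
  composite is a shift by 2; hence the two starting vertices. The mirrors are tangent, so the
  composite is parabolic, which explains the quadratic dependence on \<open>k\<close>.\<close>

lemma chain_reflections:
  "srefl (1, 0, 2 * sgb y, 0) (chain (x, y, z) k) = chain (x, y, z) (2 - k)"
  "srefl (1, 0, 0, 2 * sgb z) (chain (x, y, z) k) = chain (x, y, z) (- k)"
  by (cases x; cases y; cases z; simp add: chain_def Let_def power2_eq_square algebra_simps)+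

lemma chain_act:
  "\<exists>ws w. set ws \<subseteq> duals \<and> w \<in> vertices \<and> form (1, sgb x, sgb y, sgb z) w = - 1 \<and>
     act ws (1, sgb x, sgb y, sgb z) = (1, sgb x, sgb y, sgb z) \<and> act ws w = chain (x, y, z) (int k)"
proof (induction k rule: nat_induct2)
  case 0
  show ?case
    by (intro exI[of _ "[]"] exI[of _ "(1, sgb x, - sgb y, sgb z)"])
      (cases x; cases y; cases z; simp add: vertices_eq chain_def)
next
  case 1
  show ?case
    by (intro exI[of _ "[]"] exI[of _ "(1, sgb x, sgb y, - sgb z)"])
      (cases x; cases y; cases z; simp add: vertices_eq chain_def)
next
  case (step k)
  let ?d = "(1, 0, 2 * sgb y, 0)" and ?e = "(1, 0, 0, 2 * sgb z)" and ?v = "(1, sgb x, sgb y, sgb z)"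
  obtain ws w where IH: "set ws \<subseteq> duals" "w \<in> vertices" "form ?v w = - 1" "act ws ?v = ?v"
    "act ws w = chain (x, y, z) (int k)" using step by blast
  have "set (?d # ?e # ws) \<subseteq> duals" using IH(1) by (auto simp: duals_def)
  moreover have "act (?d # ?e # ws) ?v = ?v" using IH(4)
    by (cases x; cases y; cases z; simp add: Let_def)
  moreover have "act (?d # ?e # ws) w = chain (x, y, z) (int (k + 2))"
    using IH(5) by (simp add: chain_reflections del: srefl.simps)
  ultimately show ?case using IH(2,3) by blast
qed

section \<open>The packing as an orbit of vectors\<close>

text \<open>Lagrange's identity bounds the square of the left side by p q P Q, and the inequality of
  arithmetic and geometric means compares this with the square of the right side.\<close>

lemma null_cauchy_schwarz:
  fixes p q P Q :: real
  assumes "p \<ge> 0" "q \<ge> 0" "P \<ge> 0" "Q \<ge> 0" "x * x + y * y \<le> p * q" "X * X + Y * Y \<le> P * Q"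
  shows "\<bar>x * X + y * Y\<bar> \<le> (p * Q + q * P) / 2"
proof (rule power2_le_imp_le)
  have 1: "\<bar>x * X + y * Y\<bar>\<^sup>2 + (x * Y - y * X)\<^sup>2 = (x * x + y * y) * (X * X + Y * Y)"
    by (simp add: power2_eq_square algebra_simps)
  have 2: "(x * x + y * y) * (X * X + Y * Y) \<le> (p * q) * (P * Q)"
    using assms by (intro mult_mono) auto
  have 3: "(p * q) * (P * Q) + ((p * Q - q * P) / 2)\<^sup>2 = ((p * Q + q * P) / 2)\<^sup>2"
    by (simp add: power2_eq_square field_simps)
  show "\<bar>x * X + y * Y\<bar>\<^sup>2 \<le> ((p * Q + q * P) / 2)\<^sup>2"
    using 1 2 3 zero_le_power2[of "x * Y - y * X"] zero_le_power2[of "(p * Q - q * P) / 2"] by linarith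
qed (use assms in simp)

text \<open>A non-spacelike vector with negative product with the future vector \<open>W\<close>
  lies in the closed future cone, as do all points; two vectors of that cone have non-positive
  product.\<close>

lemma future_causal:
  assumes W: "mink W W < 0" "fst W > 0" and y: "mink y y \<le> 0" "mink y W < 0"
  shows "fst y \<ge> 0" "mink y (pt p) \<le> 0"
proof -
  obtain K H X Y where Wc: "W = (K, H, X, Y)" by (cases W)
  obtain k h a b where yc: "y = (k, h, a, b)" by (cases y)
  have KH: "X * X + Y * Y < K * H" "K > 0" using W by (simp_all add: Wc mult.commute)
  have "X * X + Y * Y \<ge> 0" by simp
  with KH mult_nonneg_nonpos[of K H] have "H > 0" by force
  have kh: "a * a + b * b \<le> k * h" using y by (simp add: yc mult.commute)
  moreover have "a * a + b * b \<ge> 0" by simp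
  ultimately have "k * h \<ge> 0" by linarith
  then have "k \<ge> 0 \<and> h \<ge> 0 \<or> k \<le> 0 \<and> h \<le> 0" by (simp add: zero_le_mult_iff)
  moreover have False if "k \<le> 0" "h \<le> 0"
  proof -
    have "\<bar>a * X + b * Y\<bar> \<le> ((- k) * H + (- h) * K) / 2"
      using that KH kh \<open>H > 0\<close> by (intro null_cauchy_schwarz) auto
    then have "- (a * X + b * Y) \<le> ((- k) * H + (- h) * K) / 2" by (rule abs_le_D2)
    then have "a * X + b * Y \<ge> (k * H + h * K) / 2" by (simp add: field_simps)
    with y(2) show False by (simp add: yc Wc)
  qed
  ultimately have nn: "k \<ge> 0" "h \<ge> 0" by auto
  then show "fst y \<ge> 0" by (simp add: yc)
  show "mink y (pt p) \<le> 0"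
  proof (cases p)
    case (Some z)
    have "\<bar>a * Re z + b * Im z\<bar> \<le> (k * ((Re z)\<^sup>2 + (Im z)\<^sup>2) + h * 1) / 2"
      using nn kh by (intro null_cauchy_schwarz) (auto simp: power2_eq_square)
    from abs_le_D1[OF this] show ?thesis by (simp add: Some yc)
  qed (use nn in \<open>simp add: yc\<close>)
qed

section \<open>Curvatures and tangencies of the orbit\<close>

locale cube_frame =
  fixes W E\<^sub>1 E\<^sub>2 E\<^sub>3 :: vec
  assumes frame: "frame W E\<^sub>1 E\<^sub>2 E\<^sub>3" and future: "fst W > 0"
begin

fun L :: "quad \<Rightarrow> vec" where
  "L (a, b, c, d) = comb W E\<^sub>1 E\<^sub>2 E\<^sub>3 (of_int a, of_int b, of_int c, of_int d)"

definition packing :: "eplane set set" where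
  "packing = {locus (L (act ws v)) |ws v. set ws \<subseteq> duals \<and> v \<in> vertices}"

lemma packingI: "set ws \<subseteq> duals \<Longrightarrow> v \<in> vertices \<Longrightarrow> locus (L (act ws v)) \<in> packing"
  unfolding packing_def by blast

lemma packingE:
  assumes "C \<in> packing"
  obtains ws v where "set ws \<subseteq> duals" "v \<in> vertices" "C = locus (L (act ws v))"
  using assms unfolding packing_def by blast

lemma mink_L: "mink (L p) (L q) = of_int (form p q)"
  by (cases p; cases q) (simp add: frame_mink[OF frame])

lemma mink_L_W: "mink (L q) W = - 2 * of_int (fst q)"
proof -
  have "W = L (1, 0, 0, 0)" by (simp add: comb_def)
  then have "mink (L q) W = of_int (form q (1, 0, 0, 0))" using mink_L by metis
  then show ?thesis by (cases q) simp
qed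

lemma L_srefl: "L (srefl d q) = L q - of_int (form q d) *\<^sub>R L d"
  by (cases d; cases q) (simp add: comb_def Let_def algebra_simps)

lemma L_act_unit: "set ws \<subseteq> duals \<Longrightarrow> v \<in> vertices \<Longrightarrow> mink (L (act ws v)) (L (act ws v)) = 1"
  by (simp add: mink_L form_act form_vertex_self)

text \<open>The sum has norm 2 + 2c with c \<le> -1, so it is non-spacelike, and the positive
  coordinates along \<open>W\<close> make it future-directed. In particular no point lies on the
  positive side of both vectors.\<close>

lemma L_sum_future:
  assumes "set ws \<subseteq> duals" "set ws' \<subseteq> duals" "v \<in> vertices" "w \<in> vertices"
    and "form (act ws v) (act ws' w) \<le> - 1"
  shows "fst (L (act ws v)) + fst (L (act ws' w)) \<ge> 0"
    "mink (L (act ws v)) (pt p) + mink (L (act ws' w)) (pt p) \<le> 0"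
proof -
  let ?u = "L (act ws v)" and ?u' = "L (act ws' w)"
  have "real_of_int (form (act ws v) (act ws' w)) \<le> - 1" using assms(5) by linarith
  then have "mink (?u + ?u') (?u + ?u') \<le> 0"
    using assms L_act_unit[of ws v] L_act_unit[of ws' w]
    by (simp add: mink_linear mink_commute[of ?u' ?u]) (simp add: mink_L)
  moreover have "mink (?u + ?u') W < 0"
    using fst_act_pos[of ws v] fst_act_pos[of ws' w] assms by (simp add: mink_linear mink_L_W)
  moreover have "mink W W < 0" using frame by (simp add: frame_def)
  ultimately have "fst (?u + ?u') \<ge> 0" "mink (?u + ?u') (pt p) \<le> 0"
    using future_causal[of W "?u + ?u'"] future by blast+
  then show "fst ?u + fst ?u' \<ge> 0" "mink ?u (pt p) + mink ?u' (pt p) \<le> 0"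
    by (simp_all add: mink_linear)
qed

lemma tangent_L:
  assumes "set ws \<subseteq> duals" "set ws' \<subseteq> duals" "v \<in> vertices" "w \<in> vertices"
    and "form (act ws v) (act ws' w) = - 1"
  shows "tangent (locus (L (act ws v))) (locus (L (act ws' w)))"
proof (rule mink_eq_minus_1_imp_tangent)
  have "mink (L (act ws v) + L (act ws' w)) W < 0"
    using fst_act_pos[of ws v] fst_act_pos[of ws' w] assms by (simp add: mink_linear mink_L_W)
  then show "L (act ws v) + L (act ws' w) \<noteq> 0" by auto
qed (use assms in \<open>simp_all add: mink_L form_act form_vertex_self\<close>)

lemma locus_disjoint_pos_side:
  assumes "set ws \<subseteq> duals" "set ws' \<subseteq> duals" "v \<in> vertices" "w \<in> vertices"
    and "form (act ws v) (act ws' w) \<le> - 1"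
  shows "locus (L (act ws' w)) \<inter> pos_side (L (act ws v)) = {}"
proof -
  have False if "p \<in> locus (L (act ws' w))" "p \<in> pos_side (L (act ws v))" for p
    using L_sum_future(2)[OF assms, of p] that by (simp add: locus_def pos_side_def)
  then show ?thesis by blast
qed

lemma radius_circ: "r > 0 \<Longrightarrow> radius (circ c r) = r"
  unfolding radius_def by (rule the_equality) (auto simp: circ_eq_iff)

text \<open>The sign of a curvature refers to all other circles. If the positive side is an
  exterior, separation puts every other circle into the closed disc; if it is a disc, one circle
  escaping that disc must be exhibited.\<close>

lemma curvature_packing:
  assumes ws: "set ws \<subseteq> duals" and v: "v \<in> vertices"
  shows "curvature packing (locus (L (act ws v))) = fst (L (act ws v))"
proof -
  let ?u = "L (act ws v)"
  note unit = L_act_unit[OF assms]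
  show ?thesis
    using unit
  proof (cases ?u rule: unit_vec_cases)
    case (line p w)
    then have "is_line (locus ?u)" using locus_line_iff[OF unit] by simp
    then show ?thesis using line(2) by (simp add: curvature_def)
  next
    case (codisc c r)
    have C: "locus ?u = circ c r" using codisc by (simp add: locus_circ_vec)
    have nl: "\<not> is_line (locus ?u)" using locus_line_iff[OF unit] codisc(1,2) by simp
    have "encloses (locus ?u) D" if D: "D \<in> packing - {locus ?u}" for D
    proof -
      obtain ws' w where w: "set ws' \<subseteq> duals" "w \<in> vertices" "D = locus (L (act ws' w))"
        using DiffD1[OF D] by (rule packingE)
      then have "act ws v \<noteq> act ws' w" using D by auto
      then have "form (act ws v) (act ws' w) \<le> - 1"
        using act_vertices_separated ws w v by blast
      then have "D \<inter> pos_side ?u = {}"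
        using locus_disjoint_pos_side[OF ws w(1) v w(2)] w(3) by simp
      moreover have "pos_side ?u = - (Some ` cball c r)"
        unfolding codisc(3) using codisc(1) by (rule pos_side_minus_circ_vec)
      ultimately have "D \<subseteq> Some ` cball c r" by blast
      with C codisc(1) show ?thesis unfolding encloses_def by blast
    qed
    then have "curvature packing (locus ?u) = - 1 / radius (locus ?u)"
      using nl by (simp add: curvature_def)
    then show ?thesis using codisc(1,2) by (simp add: C radius_circ)
  next
    case (disc c r)
    have C: "locus ?u = circ c r" using disc by (simp add: locus_circ_vec)
    have nl: "\<not> is_line (locus ?u)" using locus_line_iff[OF unit] disc(1,2) by simp
    \<comment> \<open>A non-adjacent vertex of the same cube: its circle is disjoint from the given
      one and avoids the open disc, so it is not enclosed.\<close>
    obtain w where w: "w \<in> vertices" "form v w < - 1"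
      using v unfolding vertices_eq by force
    let ?u' = "L (act ws w)" and ?D = "locus (L (act ws w))"
    have f: "form (act ws v) (act ws w) < - 1" using w form_act[OF ws] by simp
    have dis: "locus ?u \<inter> ?D = {}"
      using common_point_imp_ge[OF unit L_act_unit[OF ws w(1)]] f by (force simp: mink_L)
    obtain p where p: "p \<in> ?D" using locus_two_points[OF L_act_unit[OF ws w(1)]] by blast
    have "\<not> encloses (locus ?u) ?D"
    proof
      assume "encloses (locus ?u) ?D"
      then have "?D \<subseteq> Some ` cball c r"
        unfolding encloses_def C using circ_eq_iff disc(1) by metis
      moreover have "?D \<inter> Some ` ball c r = {}"
        using locus_disjoint_pos_side[OF ws ws v w(1)] f disc by (simp add: pos_side_circ_vec)
      ultimately obtain z where "p = Some z" "z \<in> cball c r" "z \<notin> ball c r" using p by blast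
      then have "p \<in> circ c r" by (auto simp: circ_def)
      with p dis C show False by blast
    qed
    moreover have "?D \<in> packing - {locus ?u}"
      using packingI[OF ws w(1)] p dis by auto
    ultimately have "curvature packing (locus ?u) = 1 / radius (locus ?u)"
      using nl unfolding curvature_def by auto
    then show ?thesis using disc(1,2) by (simp add: C radius_circ)
  qed
qed

section \<open>Dual circles and the cubic group in coordinates\<close>

definition face_dual :: "cube_vertex set \<Rightarrow> quad \<Rightarrow> bool" where
  "face_dual F d \<longleftrightarrow> (\<exists>b. F = {b} \<times> UNIV \<times> UNIV \<and> d = (1, 2 * sgb b, 0, 0) \<or>
     F = UNIV \<times> {b} \<times> UNIV \<and> d = (1, 0, 2 * sgb b, 0) \<or>
     F = UNIV \<times> UNIV \<times> {b} \<and> d = (1, 0, 0, 2 * sgb b))"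

lemma face_dual_exists: "F \<in> cube_faces \<Longrightarrow> \<exists>d\<in>duals. face_dual F d"
  unfolding cube_faces_def face_dual_def duals_def by blast

lemma face_dual_exists': "d \<in> duals \<Longrightarrow> \<exists>F\<in>cube_faces. face_dual F d"
  unfolding cube_faces_def face_dual_def duals_def by blast

lemma vrefl_scaled_dual:
  assumes "m = t *\<^sub>R L d" "t\<^sup>2 = 1 / 2"
  shows "vrefl m (L q) = L (srefl d q)"
proof -
  have "vrefl m (L q) = L q - (2 * t\<^sup>2 * mink (L q) (L d)) *\<^sub>R L d"
    by (simp add: vrefl_def assms(1) mink_linear power2_eq_square mult_ac)
  then show ?thesis by (simp add: assms(2) L_srefl mink_L)
qed

text \<open>Three vertices of the face already fix \<open>m\<close> up to scale, and unit norm
  against \<open>form d d = 2\<close> gives \<open>t\<^sup>2 = 1 / 2\<close>. The reflection depends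
  on \<open>t\<^sup>2\<close> alone.\<close>

lemma orthogonal_face_imp_dual:
  assumes fd: "face_dual F d" and m: "mink m m = 1"
    and orth: "\<And>x y z. (x, y, z) \<in> F \<Longrightarrow> mink m (L (1, sgb x, sgb y, sgb z)) = 0"
  shows "\<exists>t. m = t *\<^sub>R L d \<and> t\<^sup>2 = 1 / 2"
proof -
  define e\<^sub>1 e\<^sub>2 e\<^sub>3 where e: "e\<^sub>1 = mink m E\<^sub>1" "e\<^sub>2 = mink m E\<^sub>2" "e\<^sub>3 = mink m E\<^sub>3"
  define \<omega> where "\<omega> = mink m W"
  have o: "\<omega> + of_int (sgb x) * e\<^sub>1 + of_int (sgb y) * e\<^sub>2 + of_int (sgb z) * e\<^sub>3 = 0"
    if "(x, y, z) \<in> F" for x y z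
    using orth[OF that] by (simp add: comb_def mink_linear e \<omega>_def)
  have m_eq: "m = comb W E\<^sub>1 E\<^sub>2 E\<^sub>3 (- \<omega> / 2, e\<^sub>1, e\<^sub>2, e\<^sub>3)"
    using frame_expansion[OF frame, of m] by (simp add: e \<omega>_def)
  have "- 2 * (- \<omega> / 2) * (- \<omega> / 2) + e\<^sub>1 * e\<^sub>1 + e\<^sub>2 * e\<^sub>2 + e\<^sub>3 * e\<^sub>3 = 1"
    using m frame_mink[OF frame] m_eq by metis
  then have n: "e\<^sub>1 * e\<^sub>1 + e\<^sub>2 * e\<^sub>2 + e\<^sub>3 * e\<^sub>3 = 1 + \<omega> * \<omega> / 2" by simp
  have s: "sgb b * sgb b = 1" for b by (cases b) simp_all
  from fd obtain b where "F = {b} \<times> UNIV \<times> UNIV \<and> d = (1, 2 * sgb b, 0, 0) \<or>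
     F = UNIV \<times> {b} \<times> UNIV \<and> d = (1, 0, 2 * sgb b, 0) \<or>
     F = UNIV \<times> UNIV \<times> {b} \<and> d = (1, 0, 0, 2 * sgb b)"
    unfolding face_dual_def by blast
  then have "(- \<omega> / 2, e\<^sub>1, e\<^sub>2, e\<^sub>3) = (- \<omega> / 2) *\<^sub>R (case d of (x, y, z, w) \<Rightarrow>
      (of_int x, of_int y, of_int z, of_int w)) \<and> (- \<omega> / 2)\<^sup>2 = 1 / 2"
  proof (elim disjE conjE)
    assume "F = {b} \<times> UNIV \<times> UNIV" and d: "d = (1, 2 * sgb b, 0, 0)"
    with o[of b True True] o[of b True False] o[of b False True]
    have "e\<^sub>2 = 0" "e\<^sub>3 = 0" "\<omega> = - of_int (sgb b) * e\<^sub>1" by auto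
    with n show ?thesis by (cases b) (auto simp: d power2_eq_square)
  next
    assume "F = UNIV \<times> {b} \<times> UNIV" and d: "d = (1, 0, 2 * sgb b, 0)"
    with o[of True b True] o[of True b False] o[of False b True]
    have "e\<^sub>1 = 0" "e\<^sub>3 = 0" "\<omega> = - of_int (sgb b) * e\<^sub>2" by auto
    with n show ?thesis by (cases b) (auto simp: d power2_eq_square)
  next
    assume "F = UNIV \<times> UNIV \<times> {b}" and d: "d = (1, 0, 0, 2 * sgb b)"
    with o[of True True b] o[of True False b] o[of False True b]
    have "e\<^sub>1 = 0" "e\<^sub>2 = 0" "\<omega> = - of_int (sgb b) * e\<^sub>3" by auto
    with n show ?thesis by (cases b) (auto simp: d power2_eq_square)
  qed
  then have "m = (- \<omega> / 2) *\<^sub>R L d \<and> (- \<omega> / 2)\<^sup>2 = 1 / 2"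
    unfolding m_eq by (cases d) (simp only: linear_scale[OF linear_comb] L.simps prod.case)
  then show ?thesis by blast
qed

lemma dual_inversion_image:
  assumes C: "\<And>x y z. C (x, y, z) = locus (L (1, sgb x, sgb y, sgb z))"
    and fd: "face_dual F d" and dual: "dual_circle C F D" and inv: "inversion_in D s"
  shows "s ` locus (L q) = locus (L (srefl d q))"
proof -
  have "gen_circle D" using dual by (simp add: dual_circle_def)
  then obtain m where m: "mink m m = 1" "locus m = D" by (rule gen_circle_imp_vec)
  have "mink m (L (1, sgb x, sgb y, sgb z)) = 0" if "(x, y, z) \<in> F" for x y z
  proof (rule orthogonal_circles_imp[OF _ m])
    show "orthogonal_circles D (C (x, y, z))" using dual that by (auto simp: dual_circle_def)
    show "mink (L (1, sgb x, sgb y, sgb z)) (L (1, sgb x, sgb y, sgb z)) = 1"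
      by (cases x; cases y; cases z; simp add: mink_L del: L.simps)
  qed (rule C[symmetric])
  then obtain t where "m = t *\<^sub>R L d" "t\<^sup>2 = 1 / 2" using orthogonal_face_imp_dual[OF fd m(1)] by blast
  then show ?thesis using inversion_image_locus[OF inv m] vrefl_scaled_dual by simp
qed

text \<open>Every generator is an inversion for a face of the initial cube and is composed on the
  left; this matches \<open>act\<close>, where the leading letter acts last.\<close>

lemma cubic_group_imp_act:
  assumes C: "\<And>x y z. C (x, y, z) = locus (L (1, sgb x, sgb y, sgb z))"
    and "g \<in> cubic_group C"
  shows "\<exists>ws. set ws \<subseteq> duals \<and> (\<forall>q. g ` locus (L q) = locus (L (act ws q)))"
  using assms(2)
proof induction
  case one
  show ?case by (rule exI[of _ "[]"]) simp
next
  case (step g F D s)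
  then obtain ws where ws: "set ws \<subseteq> duals" "\<And>q. g ` locus (L q) = locus (L (act ws q))" by blast
  obtain d where d: "d \<in> duals" "face_dual F d" using face_dual_exists[OF step(2)] by blast
  have "(s \<circ> g) ` locus (L q) = locus (L (act (d # ws) q))" for q
    unfolding image_comp[symmetric] ws(2) dual_inversion_image[OF C d(2) step(3,4)] by simp
  with ws d show ?case by (intro exI[of _ "d # ws"]) auto
qed

lemma gen_circle_inversion: "gen_circle D \<Longrightarrow> \<exists>s. inversion_in D s"
  unfolding gen_circle_def is_circle_def is_line_def using inversion_in.intros by blast

lemma act_imp_cubic_group:
  assumes C: "\<And>x y z. C (x, y, z) = locus (L (1, sgb x, sgb y, sgb z))"
    and conf: "cubic_configuration C" and "set ws \<subseteq> duals"
  shows "\<exists>g \<in> cubic_group C. \<forall>q. g ` locus (L q) = locus (L (act ws q))"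
  using assms(3)
proof (induction ws)
  case Nil
  show ?case by (rule bexI[of _ id]) (auto intro: cubic_group.one)
next
  case (Cons d ws)
  then obtain g where g: "g \<in> cubic_group C" "\<And>q. g ` locus (L q) = locus (L (act ws q))" by auto
  obtain F where F: "F \<in> cube_faces" "face_dual F d" using face_dual_exists'[of d] Cons by auto
  then obtain D where D: "dual_circle C F D" using conf by (auto simp: cubic_configuration_def)
  then have "gen_circle D" by (simp add: dual_circle_def)
  then obtain s where s: "inversion_in D s" using gen_circle_inversion by blast
  have "(s \<circ> g) ` locus (L q) = locus (L (act (d # ws) q))" for q
    unfolding image_comp[symmetric] g(2) dual_inversion_image[OF C F(2) D s] by simp
  moreover have "s \<circ> g \<in> cubic_group C" using cubic_group.step[OF g(1) F(1) D s] .
  ultimately show ?case by blast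
qed

lemma packing_eq:
  assumes C: "\<And>x y z. C (x, y, z) = locus (L (1, sgb x, sgb y, sgb z))"
    and conf: "cubic_configuration C"
  shows "{g ` C v |g v. g \<in> cubic_group C} = packing"
proof -
  have vert: "\<exists>w\<in>vertices. C v = locus (L w)" for v
    using C by (cases v) (auto simp: vertices_def simp del: L.simps)
  have vert': "\<exists>v. C v = locus (L w)" if "w \<in> vertices" for w
    using C that by (auto simp: vertices_def simp del: L.simps)
  show ?thesis
  proof (intro equalityI subsetI)
    fix D assume "D \<in> {g ` C v |g v. g \<in> cubic_group C}"
    then obtain g v where "g \<in> cubic_group C" "D = g ` C v" by blast
    moreover obtain w where "w \<in> vertices" "C v = locus (L w)" using vert by blast
    ultimately show "D \<in> packing" using cubic_group_imp_act[OF C] packingI by metis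
  next
    fix D assume "D \<in> packing"
    then obtain ws w where "set ws \<subseteq> duals" "w \<in> vertices" "D = locus (L (act ws w))" by (rule packingE)
    moreover obtain v where "C v = locus (L w)" using vert' calculation by blast
    ultimately show "D \<in> {g ` C v |g v. g \<in> cubic_group C}"
      using act_imp_cubic_group[OF C conf] by (metis (mono_tags, lifting) mem_Collect_eq)
  qed
qed

end

lemma cubic_packing_imp_frame:
  assumes "cubic_packing P"
  obtains W E\<^sub>1 E\<^sub>2 E\<^sub>3 where "cube_frame W E\<^sub>1 E\<^sub>2 E\<^sub>3" "P = cube_frame.packing W E\<^sub>1 E\<^sub>2 E\<^sub>3"
proof -
  obtain C where C: "cubic_configuration C" "P = {g ` C v |g v. g \<in> cubic_group C}"
    using assms unfolding cubic_packing_def by blast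
  obtain W E\<^sub>1 E\<^sub>2 E\<^sub>3 where f: "frame W E\<^sub>1 E\<^sub>2 E\<^sub>3" "fst W > 0"
    "\<And>x y z. C (x, y, z) = locus (comb W E\<^sub>1 E\<^sub>2 E\<^sub>3 (1, sgb x, sgb y, sgb z))"
    using cubic_configuration_frame[OF C(1)] by blast
  interpret cube_frame W E\<^sub>1 E\<^sub>2 E\<^sub>3 using f by unfold_locales
  have "P = packing" unfolding C(2) by (rule packing_eq[OF _ C(1)]) (simp add: f(3))
  then show ?thesis using that cube_frame_axioms by blast
qed

section \<open>Arithmetic\<close>

lemma kronecker_prime_unit:
  assumes "prime p" "\<not> p dvd m"
  shows "kronecker_prime m p = 1 \<or> kronecker_prime m p = - 1"
  using assms by (auto simp: kronecker_prime_def Legendre_def cong_0_iff)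

text \<open>All multiplicities are even, so each prime contributes the square of a sign. The lower
  entry is positive, so \<open>m\<close> may be negative, as in the application to -\<rho>.\<close>

lemma kronecker_square:
  assumes "n \<noteq> 0" "coprime m n"
  shows "kronecker m (n\<^sup>2) = 1"
proof -
  have "kronecker_prime m p ^ multiplicity p (n\<^sup>2) = 1" if p: "p \<in> prime_factors (n\<^sup>2)" for p
  proof -
    have pr: "prime p" "p dvd n" using p by (auto simp: in_prime_factors_iff prime_dvd_power_iff)
    then have "\<not> p dvd m" using assms(2) by (meson coprime_common_divisor not_prime_unit)
    then have "kronecker_prime m p = 1 \<or> kronecker_prime m p = - 1"
      using kronecker_prime_unit pr by blast
    moreover have "multiplicity p (n\<^sup>2) = 2 * multiplicity p n"
      by (rule prime_elem_multiplicity_power_distrib[OF prime_imp_prime_elem[OF pr(1)] assms(1)])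
    ultimately show ?thesis by (auto simp: power_mult)
  qed
  then have "(\<Prod>p\<in>prime_factors (n\<^sup>2). kronecker_prime m p ^ multiplicity p (n\<^sup>2)) = 1"
    by (rule prod.neutral[rule_format])
  moreover have "\<not> n\<^sup>2 < 0" by (simp add: not_less)
  ultimately show ?thesis using assms unfolding kronecker_def by simp
qed

text \<open>Odd primes behave as for a square. The multiplicity of 2 is odd, so the symbol over 2
  survives, and \<open>m mod 8 = 1\<close> makes it 1.\<close>

lemma kronecker_twice_square:
  assumes "n \<noteq> 0" "coprime m n" "m mod 8 = 1"
  shows "kronecker m (2 * n\<^sup>2) = 1"
proof -
  have "kronecker_prime m p ^ multiplicity p (2 * n\<^sup>2) = 1" if p: "p \<in> prime_factors (2 * n\<^sup>2)" for p
  proof (cases "p = 2")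
    case True
    have "odd m" using assms(3) by presburger
    with True assms(3) show ?thesis by (simp add: kronecker_prime_def)
  next
    case False
    have pr: "prime p" "p dvd 2 \<or> p dvd n"
      using p by (auto simp: in_prime_factors_iff prime_dvd_power_iff prime_dvd_mult_iff)
    have p2: "\<not> p dvd 2" using False prime_ge_2_int[OF pr(1)] zdvd_imp_le[of p 2] by auto
    then have "p dvd n" using pr by simp
    then have "\<not> p dvd m" using assms(2) pr(1) by (meson coprime_common_divisor not_prime_unit)
    then have "kronecker_prime m p = 1 \<or> kronecker_prime m p = - 1"
      using kronecker_prime_unit pr by blast
    moreover have "multiplicity p (2 * n\<^sup>2) = 2 * multiplicity p n"
      using assms p2 prime_imp_prime_elem[OF pr(1)]
      by (simp add: prime_elem_multiplicity_mult_distrib prime_elem_multiplicity_power_distrib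
          not_dvd_imp_multiplicity_0)
    ultimately show ?thesis by (auto simp: power_mult)
  qed
  then have "(\<Prod>p\<in>prime_factors (2 * n\<^sup>2). kronecker_prime m p ^ multiplicity p (2 * n\<^sup>2)) = 1"
    by (rule prod.neutral[rule_format])
  moreover have "\<not> 2 * n\<^sup>2 < 0" by (simp add: not_less)
  ultimately show ?thesis using assms unfolding kronecker_def by simp
qed

section \<open>Residues modulo 8 of odd divisors of z^2 + 2 a^2\<close>

lemma odd_square_mod_8: "odd h \<Longrightarrow> h\<^sup>2 mod 8 = 1" for h :: int
proof -
  assume "odd h"
  then have "h mod 8 = 1 \<or> h mod 8 = 3 \<or> h mod 8 = 5 \<or> h mod 8 = 7" by presburger
  then have "(h mod 8)\<^sup>2 mod 8 = 1" by (elim disjE) simp_all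
  then show ?thesis by (simp add: power_mod)
qed

text \<open>Descent: for odd \<open>h < r\<close> with \<open>r\<close> dividing \<open>h\<^sup>2 + 2\<close>, the cofactor is smaller than \<open>r\<close> and
  \<open>h\<^sup>2 + 2 \<equiv> 3\<close> modulo \<open>8\<close>.\<close>

lemma odd_dvd_square_plus_2:
  fixes r z :: int
  assumes "odd r" "r > 0" "r dvd z\<^sup>2 + 2"
  shows "r mod 8 = 1 \<or> r mod 8 = 3"
  using assms
proof (induction "nat r" arbitrary: r z rule: less_induct)
  case less
  show ?case
  proof (cases "r = 1")
    case False
    have "\<not> r dvd z"
    proof
      assume "r dvd z"
      then have "r dvd z\<^sup>2" by (simp add: power2_eq_square)
      with less.prems(3) have "r dvd 2" by (simp add: dvd_add_right_iff)
      then have "r \<le> 2" by (rule zdvd_imp_le) simp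
      with less.prems(1,2) have "r = 1" by presburger
      with False show False by contradiction
    qed
    have "\<exists>h. odd h \<and> 0 < h \<and> h < r \<and> r dvd h\<^sup>2 + 2"
    proof -
      define g where "g = z mod r"
      have "g \<noteq> 0" using \<open>\<not> r dvd z\<close> by (simp add: g_def dvd_eq_mod_eq_0)
      moreover have "g \<ge> 0" "g < r" using less.prems(2) by (simp_all add: g_def)
      ultimately have g: "0 < g" "g < r" by simp_all
      have "[g = z] (mod r)" by (simp add: g_def cong_def)
      then have "[g\<^sup>2 + 2 = z\<^sup>2 + 2] (mod r)" by (intro cong_add cong_pow) auto
      then have "r dvd g\<^sup>2 + 2" using less.prems(3) cong_dvd_iff by blast
      \<comment> \<open>Since \<open>r\<close> is odd, one of \<open>g\<close> and
        \<open>r - g\<close> is odd, and both have the same square modulo \<open>r\<close>.\<close>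
      moreover have "r dvd (r - g)\<^sup>2 + 2"
      proof -
        have "(r - g)\<^sup>2 + 2 = r * (r - 2 * g) + (g\<^sup>2 + 2)"
          by (simp add: power2_eq_square algebra_simps)
        with \<open>r dvd g\<^sup>2 + 2\<close> show ?thesis by (metis dvd_add dvd_triv_left)
      qed
      moreover have "odd g \<or> odd (r - g)" using less.prems(1) by simp
      ultimately show ?thesis using g by (cases "odd g") (auto intro: exI[of _ "r - g"])
    qed
    then obtain h where h: "odd h" "0 < h" "h < r" "r dvd h\<^sup>2 + 2" by blast
    then obtain s where s: "h\<^sup>2 + 2 = r * s" by (auto elim: dvdE)
    have "odd (r * s)" using h(1) s[symmetric] by simp
    then have "odd s" by simp
    have "r * s > 0" using s[symmetric] by (simp add: add_nonneg_pos)
    with less.prems(2) have "s > 0" by (simp add: zero_less_mult_iff)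
    have "h\<^sup>2 \<le> (r - 1)\<^sup>2" using h by (intro power_mono) auto
    then have "r * s \<le> (r - 1)\<^sup>2 + 2" using s by simp
    \<comment> \<open>Strictness amounts to \<open>2 * r > 3\<close>, which follows from
      \<open>0 < h < r\<close>.\<close>
    also have "\<dots> < r * r" using h by (simp add: power2_eq_square algebra_simps)
    finally have "s < r" using less.prems(2) by simp
    then have "s mod 8 = 1 \<or> s mod 8 = 3"
      using less.hyps[of s h] \<open>odd s\<close> \<open>s > 0\<close> s less.prems(2) by simp
    moreover have "(r mod 8) * (s mod 8) mod 8 = 3"
    proof -
      have "(h\<^sup>2 + 2) mod 8 = 3" using odd_square_mod_8[OF h(1)] by presburger
      then show ?thesis unfolding s by (simp add: mod_mult_eq)
    qed
    moreover have "r mod 8 = 1 \<or> r mod 8 = 3 \<or> r mod 8 = 5 \<or> r mod 8 = 7"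
      using less.prems(1) by presburger
    ultimately show ?thesis by auto
  qed simp
qed

text \<open>Multiplying \<open>z\<close> by an inverse of \<open>a\<close> modulo \<open>r\<close>
  reduces the claim to a = 1.\<close>

lemma odd_dvd_square_plus_twice_square:
  fixes r z a :: int
  assumes "odd r" "r > 0" "coprime r a" "r dvd z\<^sup>2 + 2 * a\<^sup>2"
  shows "r mod 8 = 1 \<or> r mod 8 = 3"
proof -
  obtain c where c: "[a * c = 1] (mod r)"
    using assms(3) cong_solve_coprime_int[of a r] by (auto simp: coprime_commute)
  have "[(z * c)\<^sup>2 + 2 * 1\<^sup>2 = (z * c)\<^sup>2 + 2 * (a * c)\<^sup>2] (mod r)"
    using c by (intro cong_add cong_mult cong_pow cong_refl) (simp add: cong_sym)
  moreover have "(z * c)\<^sup>2 + 2 * (a * c)\<^sup>2 = (z\<^sup>2 + 2 * a\<^sup>2) * c\<^sup>2"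
    by (simp add: power_mult_distrib algebra_simps)
  ultimately have "r dvd (z * c)\<^sup>2 + 2"
    using assms(4) cong_dvd_iff by (metis dvd_mult2 mult.right_neutral one_power2)
  then show ?thesis using odd_dvd_square_plus_2 assms by blast
qed

section \<open>Coprime values of a binary form, and coprime factors of a square\<close>

lemma not_coprime_imp_common_prime:
  fixes x y :: int
  assumes "\<not> coprime x y"
  obtains p where "prime p" "p dvd x" "p dvd y"
proof (cases "gcd x y = 0")
  case True
  then show ?thesis using that[of 2] by simp
next
  case False
  moreover have "\<not> is_unit (gcd x y)" using assms by (simp add: coprime_iff_gcd_eq_1)
  ultimately obtain p where "prime p" "p dvd gcd x y" using prime_divisor_exists by blast
  then show ?thesis using that by simp
qed

lemma form_represents_coprime:
  fixes X Y h a :: int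
  assumes eq: "X * Y = h\<^sup>2 + 2 * a\<^sup>2" and "a \<noteq> 0"
    and prim: "\<And>p. prime p \<Longrightarrow> p dvd a \<Longrightarrow> p dvd X \<Longrightarrow> p dvd Y \<Longrightarrow> p dvd X + Y + 2 * h \<Longrightarrow> False"
  obtains k :: nat where "coprime (X * (int k)\<^sup>2 + 2 * h * int k + Y) a"
proof -
  define S where "S = {p \<in> prime_factors a. \<not> p dvd Y}"
  define K where "K = \<Prod>S"
  have S: "finite S" "\<And>p. p \<in> S \<Longrightarrow> prime p" by (auto simp: S_def)
  then have "K \<ge> 0" unfolding K_def by (intro prod_nonneg) (simp add: prime_ge_0_int)
  have dvdK: "p dvd K \<longleftrightarrow> \<not> p dvd Y" if "prime p" "p dvd a" for p
  proof -
    have "p dvd K \<longleftrightarrow> (\<exists>q\<in>S. p dvd q)"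
      unfolding K_def using prime_dvd_prod_iff[OF S(1) that(1)] by simp
    also have "\<dots> \<longleftrightarrow> p \<in> S" using primes_dvd_imp_eq[OF that(1) S(2)] by (auto intro: bexI[of _ p])
    finally show ?thesis using that \<open>a \<noteq> 0\<close> by (simp add: S_def in_prime_factors_iff)
  qed
  have "coprime (X * K\<^sup>2 + 2 * h * K + Y) a"
  proof (rule ccontr)
    assume "\<not> coprime (X * K\<^sup>2 + 2 * h * K + Y) a"
    then obtain p where p: "prime p" and pf: "p dvd X * K\<^sup>2 + 2 * h * K + Y" and pa: "p dvd a"
      by (rule not_coprime_imp_common_prime)
    show False
    proof (cases "p dvd Y")
      case False
      then have "p dvd K" using dvdK p pa by blast
      then have "p dvd X * K\<^sup>2 + 2 * h * K" by (simp add: power2_eq_square)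
      with pf False show False by (simp add: dvd_add_right_iff)
    next
      case True
      have "p dvd h\<^sup>2 + 2 * a\<^sup>2" unfolding eq[symmetric] using True by simp
      moreover have "p dvd 2 * a\<^sup>2" using pa by (simp add: power2_eq_square)
      ultimately have "p dvd h\<^sup>2" by (simp add: dvd_add_left_iff)
      then have ph: "p dvd h" using p by (simp add: prime_dvd_power_iff)
      have "p dvd 2 * h * K + Y" using ph True by simp
      then have "p dvd X * K\<^sup>2" using pf by (simp add: add.assoc dvd_add_left_iff)
      moreover have "\<not> p dvd K" using dvdK p pa True by blast
      ultimately have "p dvd X" using p by (simp add: prime_dvd_mult_iff prime_dvd_power_iff)
      moreover from this have "p dvd X + Y + 2 * h" using True ph by simp
      ultimately show False using prim[OF p pa] True by blast
    qed
  qed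
  with that[of "nat K"] \<open>K \<ge> 0\<close> show ?thesis by simp
qed

text \<open>Coprimality gives gcd(X^2, h^2) = gcd(X X, X Y) = X, so X is the square of gcd(X,
  h).\<close>

lemma coprime_mult_square:
  fixes X Y h :: int
  assumes "coprime X Y" "X * Y = h\<^sup>2" "X \<ge> 0" "Y \<ge> 0"
  obtains x where "X = x\<^sup>2"
proof -
  have X: "gcd (X * X) (X * Y) = X" using assms(1,3) unfolding gcd_mult_left by simp
  have "X dvd (gcd X h)\<^sup>2"
  proof -
    have "gcd (X\<^sup>2) (h\<^sup>2) = X" using X unfolding assms(2) power2_eq_square[of X] .
    then show ?thesis by (simp add: gcd_exp)
  qed
  moreover have "(gcd X h)\<^sup>2 dvd X"
  proof -
    have "(gcd X h)\<^sup>2 dvd gcd (X * X) (X * Y)"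
      unfolding assms(2) by (simp add: power2_eq_square mult_dvd_mono)
    then show ?thesis unfolding X .
  qed
  ultimately have "X = (gcd X h)\<^sup>2" using assms(3) by (simp add: zdvd_antisym_nonneg)
  then show ?thesis using that by blast
qed

section \<open>Neighbours of a circle\<close>

context cube_frame
begin

text \<open>Words preserve the form, so the images of the basis are again a frame and
  \<open>frame_null\<close> applies to their curvatures.\<close>

lemma curvature_linear:
  assumes ws: "set ws \<subseteq> duals"
  obtains t\<^sub>0 t\<^sub>1 t\<^sub>2 t\<^sub>3 :: real where "t\<^sub>0\<^sup>2 = 2 * (t\<^sub>1\<^sup>2 + t\<^sub>2\<^sup>2 + t\<^sub>3\<^sup>2)"
    "\<And>a b c d. fst (L (act ws (a, b, c, d))) = of_int a * t\<^sub>0 + of_int b * t\<^sub>1 + of_int c * t\<^sub>2 + of_int d * t\<^sub>3"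
proof -
  let ?g = "\<lambda>q. L (act ws q)"
  have m: "mink (?g p) (?g q) = of_int (form p q)" for p q
    by (simp add: mink_L form_act[OF ws])
  let ?W = "?g (1, 0, 0, 0)" and ?E\<^sub>1 = "?g (0, 1, 0, 0)" and ?E\<^sub>2 = "?g (0, 0, 1, 0)" and ?E\<^sub>3 = "?g (0, 0, 0, 1)"
  have fr: "frame ?W ?E\<^sub>1 ?E\<^sub>2 ?E\<^sub>3" unfolding frame_def m by simp
  have g: "?g (a, b, c, d) = comb ?W ?E\<^sub>1 ?E\<^sub>2 ?E\<^sub>3 (of_int a, of_int b, of_int c, of_int d)" for a b c d
  proof -
    have form: "- real_of_int (form (a, b, c, d) (1, 0, 0, 0)) / 2 = of_int a"
      "real_of_int (form (a, b, c, d) (0, 1, 0, 0)) = of_int b"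
      "real_of_int (form (a, b, c, d) (0, 0, 1, 0)) = of_int c"
      "real_of_int (form (a, b, c, d) (0, 0, 0, 1)) = of_int d"
      by simp_all
    show ?thesis using frame_expansion[OF fr, of "?g (a, b, c, d)"] unfolding m form .
  qed
  have lin: "fst (?g (a, b, c, d)) = of_int a * fst ?W + of_int b * fst ?E\<^sub>1 + of_int c * fst ?E\<^sub>2 + of_int d * fst ?E\<^sub>3"
    for a b c d by (subst g) (simp add: comb_def)
  show ?thesis by (rule that[OF frame_null[OF fr] lin])
qed

text \<open>The form X s^2 + 2 h s t + Y t^2 yields the sums over neighbours: its values at (k, 1)
  come from the chain, and X at (1, 0) from a neighbour off the chain. The last clause transports
  primitivity, since a common divisor of \<open>a\<close> and three such sums divides every
  curvature.\<close>

lemma neighbour_values: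
  assumes int: "integral_packing packing" and C: "C \<in> packing"
  obtains a X Y h :: int where "curvature packing C = of_int a" "X * Y = h\<^sup>2 + 2 * a\<^sup>2" "X \<ge> 0" "Y \<ge> 0"
    "\<exists>C'\<in>packing. tangent C C' \<and> curvature packing C' = of_int (X - a)"
    "\<And>k :: nat. X * (int k)\<^sup>2 + 2 * h * int k + Y \<ge> 0 \<and>
       (\<exists>C'\<in>packing. tangent C C' \<and> curvature packing C' = of_int (X * (int k)\<^sup>2 + 2 * h * int k + Y - a))"
    "\<And>p C' m. p dvd a \<Longrightarrow> p dvd X \<Longrightarrow> p dvd Y \<Longrightarrow> p dvd X + Y + 2 * h \<Longrightarrow> C' \<in> packing \<Longrightarrow>
       curvature packing C' = of_int m \<Longrightarrow> p dvd m"
proof -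
  obtain ws v where ws: "set ws \<subseteq> duals" and v: "v \<in> vertices" and Cv: "C = locus (L (act ws v))"
    using C by (rule packingE)
  obtain x y z where vs: "v = (1, sgb x, sgb y, sgb z)" using v by (auto simp: vertices_def)
  obtain t\<^sub>0 t\<^sub>1 t\<^sub>2 t\<^sub>3 :: real where null: "t\<^sub>0\<^sup>2 = 2 * (t\<^sub>1\<^sup>2 + t\<^sub>2\<^sup>2 + t\<^sub>3\<^sup>2)"
    and lin: "\<And>a b c d. fst (L (act ws (a, b, c, d))) = of_int a * t\<^sub>0 + of_int b * t\<^sub>1 + of_int c * t\<^sub>2 + of_int d * t\<^sub>3"
    using curvature_linear[OF ws] by blast
  let ?K = "\<lambda>q. fst (L (act ws q))"
  have "\<exists>k :: int. ?K w = of_int k" if "w \<in> vertices" for w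
    using int packingI[OF ws that] curvature_packing[OF ws that]
    unfolding integral_packing_def by (metis Ints_cases)
  then obtain \<kappa> :: "quad \<Rightarrow> int" where \<kappa>: "\<And>w. w \<in> vertices \<Longrightarrow> ?K w = of_int (\<kappa> w)" by metis
  define \<epsilon>\<^sub>1 \<epsilon>\<^sub>2 \<epsilon>\<^sub>3 where e: "\<epsilon>\<^sub>1 = sgb x" "\<epsilon>\<^sub>2 = sgb y" "\<epsilon>\<^sub>3 = sgb z"
  have ee: "\<epsilon>\<^sub>1 * \<epsilon>\<^sub>1 = 1" "\<epsilon>\<^sub>2 * \<epsilon>\<^sub>2 = 1" "\<epsilon>\<^sub>3 * \<epsilon>\<^sub>3 = 1" "odd \<epsilon>\<^sub>1" "odd \<epsilon>\<^sub>2" "odd \<epsilon>\<^sub>3"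
    by (simp_all add: e sgb_def)
  let ?v\<^sub>1 = "(1, - \<epsilon>\<^sub>1, \<epsilon>\<^sub>2, \<epsilon>\<^sub>3)" and ?v\<^sub>2 = "(1, \<epsilon>\<^sub>1, - \<epsilon>\<^sub>2, \<epsilon>\<^sub>3)" and ?v\<^sub>3 = "(1, \<epsilon>\<^sub>1, \<epsilon>\<^sub>2, - \<epsilon>\<^sub>3)"
  have verts: "?v\<^sub>1 \<in> vertices" "?v\<^sub>2 \<in> vertices" "?v\<^sub>3 \<in> vertices"
    unfolding vertices_eq e by (cases x; cases y; cases z; simp)+
  define a where "a = \<kappa> v"
  define X where "X = a + \<kappa> ?v\<^sub>1"
  define Y where "Y = a + \<kappa> ?v\<^sub>2"
  define Z where "Z = a + \<kappa> ?v\<^sub>3"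
  have ra: "of_int a = t\<^sub>0 + \<epsilon>\<^sub>1 * t\<^sub>1 + \<epsilon>\<^sub>2 * t\<^sub>2 + \<epsilon>\<^sub>3 * t\<^sub>3"
    using \<kappa>[OF v] lin[of 1 \<epsilon>\<^sub>1 \<epsilon>\<^sub>2 \<epsilon>\<^sub>3] by (simp add: a_def vs e del: L.simps)
  have rX: "of_int X = of_int a + (t\<^sub>0 - \<epsilon>\<^sub>1 * t\<^sub>1 + \<epsilon>\<^sub>2 * t\<^sub>2 + \<epsilon>\<^sub>3 * t\<^sub>3)"
    using \<kappa>[OF verts(1)] lin[of 1 "- \<epsilon>\<^sub>1" \<epsilon>\<^sub>2 \<epsilon>\<^sub>3] by (simp add: X_def del: L.simps)
  have rY: "of_int Y = of_int a + (t\<^sub>0 + \<epsilon>\<^sub>1 * t\<^sub>1 - \<epsilon>\<^sub>2 * t\<^sub>2 + \<epsilon>\<^sub>3 * t\<^sub>3)"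
    using \<kappa>[OF verts(2)] lin[of 1 \<epsilon>\<^sub>1 "- \<epsilon>\<^sub>2" \<epsilon>\<^sub>3] by (simp add: Y_def del: L.simps)
  have rZ: "of_int Z = of_int a + (t\<^sub>0 + \<epsilon>\<^sub>1 * t\<^sub>1 + \<epsilon>\<^sub>2 * t\<^sub>2 - \<epsilon>\<^sub>3 * t\<^sub>3)"
    using \<kappa>[OF verts(3)] lin[of 1 \<epsilon>\<^sub>1 \<epsilon>\<^sub>2 "- \<epsilon>\<^sub>3"] by (simp add: Z_def del: L.simps)
  \<comment> \<open>The relation from the point at infinity, rewritten in the sums. It also shows
    that \<open>Z - X - Y\<close> is even, so that \<open>h\<close> is an integer.\<close>
  have disc: "(Z - X - Y)\<^sup>2 = 4 * (X * Y - 2 * a\<^sup>2)"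
  proof -
    have "(s * s = 1) \<Longrightarrow> (s * t)\<^sup>2 = t\<^sup>2" for s t :: real by (simp add: power2_eq_square)
    from this[of \<epsilon>\<^sub>1 t\<^sub>1] this[of \<epsilon>\<^sub>2 t\<^sub>2] this[of \<epsilon>\<^sub>3 t\<^sub>3] ee null
    have "t\<^sub>0\<^sup>2 = 2 * ((\<epsilon>\<^sub>1 * t\<^sub>1)\<^sup>2 + (\<epsilon>\<^sub>2 * t\<^sub>2)\<^sup>2 + (\<epsilon>\<^sub>3 * t\<^sub>3)\<^sup>2)"
      by (simp flip: of_int_mult)
    then have "(real_of_int Z - X - Y)\<^sup>2 = 4 * (real_of_int X * Y - 2 * (real_of_int a)\<^sup>2)"
      unfolding rX rY rZ ra by (simp add: power2_eq_square algebra_simps)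
    then have "real_of_int ((Z - X - Y)\<^sup>2) = real_of_int (4 * (X * Y - 2 * a\<^sup>2))" by simp
    then show ?thesis by (simp only: of_int_eq_iff)
  qed
  then have "even ((Z - X - Y)\<^sup>2)" by simp
  then have "even (Z - X - Y)" by simp
  then obtain h where h: "Z - X - Y = 2 * h" by (rule evenE)
  have eq: "X * Y = h\<^sup>2 + 2 * a\<^sup>2" using disc unfolding h by (simp add: power_mult_distrib)
  have fv: "form v ?v\<^sub>1 = - 1" "form v ?v\<^sub>2 = - 1" using ee by (simp_all add: vs e[symmetric])
  then have fo: "form (act ws v) (act ws ?v\<^sub>1) = - 1" "form (act ws v) (act ws ?v\<^sub>2) = - 1"
    unfolding form_act[OF ws] by blast+
  have sum_nonneg: "a + \<kappa>' \<ge> 0"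
    if "set ws' \<subseteq> duals" "w \<in> vertices" "form (act ws v) (act ws' w) = - 1" "fst (L (act ws' w)) = of_int \<kappa>'" for ws' w \<kappa>'
  proof -
    have "fst (L (act ws v)) + fst (L (act ws' w)) \<ge> 0"
      using L_sum_future(1)[OF ws that(1) v that(2)] that(3) by simp
    then have "real_of_int (a + \<kappa>') \<ge> 0" using \<kappa>[OF v] that(4) by (simp add: a_def)
    then show ?thesis by simp
  qed
  show ?thesis
  proof
    show "curvature packing C = of_int a"
      unfolding Cv curvature_packing[OF ws v] a_def by (rule \<kappa>[OF v])
    show "X * Y = h\<^sup>2 + 2 * a\<^sup>2" by (rule eq)
    show "X \<ge> 0" "Y \<ge> 0"
      unfolding X_def Y_def
      by (rule sum_nonneg[OF ws verts(1) fo(1) \<kappa>[OF verts(1)]])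
        (rule sum_nonneg[OF ws verts(2) fo(2) \<kappa>[OF verts(2)]])
    show "\<exists>C'\<in>packing. tangent C C' \<and> curvature packing C' = of_int (X - a)"
    proof (intro bexI conjI)
      show "tangent C (locus (L (act ws ?v\<^sub>1)))"
        unfolding Cv by (rule tangent_L[OF ws ws v verts(1) fo(1)])
      show "curvature packing (locus (L (act ws ?v\<^sub>1))) = of_int (X - a)"
        unfolding curvature_packing[OF ws verts(1)] X_def using \<kappa>[OF verts(1)] by simp
    qed (rule packingI[OF ws verts(1)])
  next
    fix k :: nat
    let ?f = "X * (int k)\<^sup>2 + 2 * h * int k + Y"
    obtain ws' w where w: "set ws' \<subseteq> duals" "w \<in> vertices" "form v w = - 1" "act ws' v = v"
      "act ws' w = chain (x, y, z) (int k)"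
      using chain_act[of x y z k] unfolding vs by blast
    have wsw: "set (ws @ ws') \<subseteq> duals" using ws w by simp
    \<comment> \<open>At \<open>k = 0\<close> and \<open>k = 1\<close> these are the initial
      neighbours, with sums Y and Z = X + Y + 2h.\<close>
    have "?K (chain (x, y, z) (int k)) = of_int (?f - a)"
    proof -
      have "2 * real_of_int h = real_of_int Z - X - Y" using arg_cong[OF h, of real_of_int] by simp
      then have "real_of_int (?f - a) = real_of_int X * (real k)\<^sup>2 + (real_of_int Z - X - Y) * real k + Y - a"
        by simp
      then show ?thesis
        unfolding chain_def prod.case lin rX rY rZ ra e
        by (simp add: power2_eq_square algebra_simps)
    qed
    then have K: "fst (L (act (ws @ ws') w)) = of_int (?f - a)" using w by simp
    have fo: "form (act ws v) (act (ws @ ws') w) = - 1"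
      using form_act[OF wsw, of v w] w(3,4) by simp
    have "?f \<ge> 0" using sum_nonneg[OF wsw w(2) fo K] by simp
    moreover have "\<exists>C'\<in>packing. tangent C C' \<and> curvature packing C' = of_int (?f - a)"
    proof (intro bexI conjI)
      show "tangent C (locus (L (act (ws @ ws') w)))"
        unfolding Cv by (rule tangent_L[OF ws wsw v w(2) fo])
      show "curvature packing (locus (L (act (ws @ ws') w))) = of_int (?f - a)"
        unfolding curvature_packing[OF wsw w(2)] by (rule K)
    qed (rule packingI[OF wsw w(2)])
    ultimately show "?f \<ge> 0 \<and> (\<exists>C'\<in>packing. tangent C C' \<and> curvature packing C' = of_int (?f - a))" ..
  next
    fix p m :: int and C'
    assume p: "p dvd a" "p dvd X" "p dvd Y" "p dvd X + Y + 2 * h" and C': "C' \<in> packing"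
      and m: "curvature packing C' = of_int m"
    obtain ws' w where w: "set ws' \<subseteq> duals" "w \<in> vertices" "C' = locus (L (act ws' w))"
      using C' by (rule packingE)
    \<comment> \<open>Coordinates of \<open>C'\<close> relative to the cube containing
      \<open>C\<close>. By parity they are \<alpha> v + \<Sigma> n_i (v - v_i), so \<open>m\<close>
      is an integral combination of \<open>a\<close> and the curvature differences 2a - X, 2a - Y,
      2a - Z.\<close>
    obtain \<alpha> \<beta>\<^sub>1 \<beta>\<^sub>2 \<beta>\<^sub>3 where q: "act (rev ws @ ws') w = (\<alpha>, \<beta>\<^sub>1, \<beta>\<^sub>2, \<beta>\<^sub>3)" by (rule prod_cases4)
    have "(\<alpha>, \<beta>\<^sub>1, \<beta>\<^sub>2, \<beta>\<^sub>3) \<in> lattice"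
      unfolding q[symmetric] using w ws by (intro act_lattice vertices_lattice) auto
    then have "even (\<beta>\<^sub>1 * \<epsilon>\<^sub>1 - \<alpha>)" "even (\<beta>\<^sub>2 * \<epsilon>\<^sub>2 - \<alpha>)" "even (\<beta>\<^sub>3 * \<epsilon>\<^sub>3 - \<alpha>)"
      using ee by (auto simp: lattice_def)
    then obtain n\<^sub>1 n\<^sub>2 n\<^sub>3 where n: "\<beta>\<^sub>1 * \<epsilon>\<^sub>1 = \<alpha> + 2 * n\<^sub>1" "\<beta>\<^sub>2 * \<epsilon>\<^sub>2 = \<alpha> + 2 * n\<^sub>2" "\<beta>\<^sub>3 * \<epsilon>\<^sub>3 = \<alpha> + 2 * n\<^sub>3"
      by (metis evenE diff_eq_eq add.commute)
    have \<beta>: "\<beta>\<^sub>1 = (\<alpha> + 2 * n\<^sub>1) * \<epsilon>\<^sub>1" "\<beta>\<^sub>2 = (\<alpha> + 2 * n\<^sub>2) * \<epsilon>\<^sub>2" "\<beta>\<^sub>3 = (\<alpha> + 2 * n\<^sub>3) * \<epsilon>\<^sub>3"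
      unfolding n[symmetric] mult.assoc ee by simp_all
    have "act ws (\<alpha>, \<beta>\<^sub>1, \<beta>\<^sub>2, \<beta>\<^sub>3) = act ws' w"
      unfolding q[symmetric] using act_rev(2)[OF ws] by simp
    then have "real_of_int m = of_int \<alpha> * t\<^sub>0 + of_int \<beta>\<^sub>1 * t\<^sub>1 + of_int \<beta>\<^sub>2 * t\<^sub>2 + of_int \<beta>\<^sub>3 * t\<^sub>3"
      using m lin[of \<alpha> \<beta>\<^sub>1 \<beta>\<^sub>2 \<beta>\<^sub>3] curvature_packing[OF w(1,2)] unfolding w(3) by simp
    also have "\<dots> = of_int (\<alpha> * a + n\<^sub>1 * (2 * a - X) + n\<^sub>2 * (2 * a - Y) + n\<^sub>3 * (2 * a - Z))"
      unfolding \<beta> by (simp add: rX rY rZ ra algebra_simps)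
    finally have "m = \<alpha> * a + n\<^sub>1 * (2 * a - X) + n\<^sub>2 * (2 * a - Y) + n\<^sub>3 * (2 * a - Z)"
      by (simp only: of_int_eq_iff)
    moreover have "p dvd Z" using p(4) h by (simp add: algebra_simps)
    ultimately show "p dvd m" using p by simp
  qed
qed

end

section \<open>From the neighbour sums to the value of the symbol\<close>

theorem theorem4p15:
  fixes P :: "eplane set set"
  assumes "cubic_packing P" and "integral_packing P" and "primitive_packing P"
    and "\<forall>C\<in>P. \<forall>k::int. curvature P C = of_int k \<longrightarrow> k mod 4 \<in> {0, 1, 2}"
    and "\<forall>C\<in>P. \<forall>C'\<in>P. \<forall>a b :: int.
           tangent C C' \<and> curvature P C = of_int a \<and> curvature P C' = of_int b \<and>
           a \<noteq> 0 \<and> coprime a b \<longrightarrow> chi_value a b = - 1"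
  shows "\<not> (\<exists>C\<in>P. \<exists>n::int. curvature P C = of_int (n\<^sup>2) \<or> curvature P C = of_int (2 * n\<^sup>2))"
proof -
  obtain W E\<^sub>1 E\<^sub>2 E\<^sub>3 where f: "cube_frame W E\<^sub>1 E\<^sub>2 E\<^sub>3" and P: "P = cube_frame.packing W E\<^sub>1 E\<^sub>2 E\<^sub>3"
    using cubic_packing_imp_frame[OF assms(1)] by blast
  note vals = cube_frame.neighbour_values[OF f, folded P, OF assms(2)]
  have prim: False
    if "prime p" "\<And>C' m. C' \<in> P \<Longrightarrow> curvature P C' = of_int m \<Longrightarrow> p dvd m" for p :: int
  proof -
    have "p dvd Gcd {k. \<exists>C\<in>P. curvature P C = of_int k}"
      by (rule Gcd_greatest) (use that(2) in blast)
    then have "p dvd 1" using assms(3) unfolding primitive_packing_def by simp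
    with that(1) show False using not_prime_unit by blast
  qed
  have nonzero: False if C: "C \<in> P" and n: "n \<noteq> 0"
    and curv: "curvature P C = of_int (n\<^sup>2) \<or> curvature P C = of_int (2 * n\<^sup>2)" for C and n :: int
  proof -
    obtain a X Y h :: int where a: "curvature P C = of_int a" and eq: "X * Y = h\<^sup>2 + 2 * a\<^sup>2"
      and chain: "\<And>k :: nat. X * (int k)\<^sup>2 + 2 * h * int k + Y \<ge> 0 \<and>
        (\<exists>C'\<in>P. tangent C C' \<and> curvature P C' = of_int (X * (int k)\<^sup>2 + 2 * h * int k + Y - a))"
      and gcd: "\<And>p C' m. p dvd a \<Longrightarrow> p dvd X \<Longrightarrow> p dvd Y \<Longrightarrow> p dvd X + Y + 2 * h \<Longrightarrow> C' \<in> P \<Longrightarrow>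
        curvature P C' = of_int m \<Longrightarrow> p dvd m"
      using vals[OF C] by metis
    have "a = n\<^sup>2 \<or> a = 2 * n\<^sup>2" using curv unfolding a of_int_eq_iff .
    with n have "a \<noteq> 0" by auto
    obtain k where cop: "coprime (X * (int k)\<^sup>2 + 2 * h * int k + Y) a"
      using form_represents_coprime[OF eq \<open>a \<noteq> 0\<close>] prim gcd by metis
    define \<rho> where "\<rho> = X * (int k)\<^sup>2 + 2 * h * int k + Y"
    obtain C' where C': "C' \<in> P" "tangent C C'" "curvature P C' = of_int (\<rho> - a)"
      using chain[of k] unfolding \<rho>_def by blast
    have "\<rho> \<ge> 0" using chain[of k] unfolding \<rho>_def by blast
    have "coprime \<rho> a" using cop by (simp add: \<rho>_def)
    then have "coprime a (\<rho> - a)" by (simp add: coprime_iff_gcd_eq_1 gcd.commute[of a] gcd_diff1)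
    then have chi: "chi_value a (\<rho> - a) = - 1"
      using assms(5) C C' a \<open>a \<noteq> 0\<close> by blast
    show False
      using \<open>a = n\<^sup>2 \<or> a = 2 * n\<^sup>2\<close>
    proof
      assume an: "a = n\<^sup>2"
      \<comment> \<open>\<open>chi_value\<close> branches on \<open>a mod 4\<close>; a square never
        enters the branch with \<open>a div 2\<close>.\<close>
      have "n\<^sup>2 mod 4 \<noteq> 2"
      proof (cases "even n")
        case True
        then show ?thesis by (auto elim!: evenE simp: power2_eq_square)
      next
        case False
        then show ?thesis using odd_square_mod_8[of n] by presburger
      qed
      moreover have "coprime \<rho> n" using \<open>coprime \<rho> a\<close> by (simp add: an)
      ultimately show False
        using chi n kronecker_square[of n \<rho>] by (simp add: chi_value_def an)
    next
      assume an: "a = 2 * n\<^sup>2"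
      have cn: "coprime \<rho> n" "odd \<rho>" using \<open>coprime \<rho> a\<close> by (simp_all add: an)
      show False
      proof (cases "even n")
        case False
        then have "a mod 4 = 2" using odd_square_mod_8[OF False] unfolding an by presburger
        moreover have "coprime (- \<rho>) n" using cn by simp
        ultimately show False
          using chi n kronecker_square[of n "- \<rho>"] by (simp add: chi_value_def an)
      next
        case True
        then have a8: "a mod 8 = 0" by (auto elim!: evenE simp: an power2_eq_square)
        \<comment> \<open>As 4 divides \<open>a\<close>, the curvature \<rho> - a of the neighbour
          has the residue of \<rho>, so the hypothesis on curvatures rules out \<rho> \<equiv> 3
          modulo 4.\<close>
        have "(\<rho> - a) mod 4 \<in> {0, 1, 2}" using assms(4) C'(1,3) by blast
        then have "(\<rho> - a) mod 4 = 1" using cn(2) a8 unfolding insert_iff empty_iff by presburger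
        \<comment> \<open>Completing the square in the form shows that -2 a^2 is a square modulo
          \<rho>.\<close>
        have "\<rho> * X = (X * int k + h)\<^sup>2 + 2 * a\<^sup>2"
          using eq by (simp add: \<rho>_def power2_eq_square algebra_simps)
        then have "\<rho> dvd (X * int k + h)\<^sup>2 + 2 * a\<^sup>2" by (metis dvd_triv_left)
        moreover have "\<rho> > 0" using \<open>\<rho> \<ge> 0\<close> cn(2) by (cases "\<rho> = 0") auto
        ultimately have "\<rho> mod 8 = 1 \<or> \<rho> mod 8 = 3"
          using odd_dvd_square_plus_twice_square cn(2) \<open>coprime \<rho> a\<close> by blast
        then have "\<rho> mod 8 = 1" using \<open>(\<rho> - a) mod 4 = 1\<close> a8 by presburger
        moreover have "a mod 4 \<noteq> 2" using a8 by presburger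
        ultimately show False
          using chi n kronecker_twice_square[of n \<rho>] cn by (simp add: chi_value_def an)
      qed
    qed
  qed
  have nonline: False if C: "C \<in> P" and C0: "curvature P C = 0" for C
  proof -
    obtain a X Y h :: int where a: "curvature P C = of_int a" and eq: "X * Y = h\<^sup>2 + 2 * a\<^sup>2"
      and nn: "X \<ge> 0" "Y \<ge> 0"
      and nx: "\<exists>C'\<in>P. tangent C C' \<and> curvature P C' = of_int (X - a)"
      and chain: "\<And>k :: nat. X * (int k)\<^sup>2 + 2 * h * int k + Y \<ge> 0 \<and>
        (\<exists>C'\<in>P. tangent C C' \<and> curvature P C' = of_int (X * (int k)\<^sup>2 + 2 * h * int k + Y - a))"
      and gcd: "\<And>p C' m. p dvd a \<Longrightarrow> p dvd X \<Longrightarrow> p dvd Y \<Longrightarrow> p dvd X + Y + 2 * h \<Longrightarrow> C' \<in> P \<Longrightarrow>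
        curvature P C' = of_int m \<Longrightarrow> p dvd m"
      by (rule vals[OF C], rule that)
    have a0: "a = 0" using a C0 by simp
    \<comment> \<open>For \<open>a = 0\<close> a common prime of X and Y divides h as well, hence
      all curvatures, against primitivity.\<close>
    have "coprime X Y"
    proof (rule ccontr)
      assume "\<not> coprime X Y"
      then obtain p where p: "prime p" "p dvd X" "p dvd Y"
        by (rule not_coprime_imp_common_prime)
      then have "p dvd X * Y" by simp
      then have "p dvd h\<^sup>2" unfolding eq by (simp add: a0)
      then have "p dvd h" using p(1) by (simp add: prime_dvd_power_iff)
      with p have sum: "p dvd X + Y + 2 * h" by simp
      have "p dvd m" if "C' \<in> P" "curvature P C' = of_int m" for C' m
        by (rule gcd[OF _ p(2,3) sum that]) (simp add: a0)
      then show False by (rule prim[OF p(1)])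
    qed
    then obtain x where "X = x\<^sup>2" using coprime_mult_square[of X Y h] eq a0 nn by auto
    obtain y where "Y = y\<^sup>2"
      using coprime_mult_square[of Y X h] \<open>coprime X Y\<close> eq a0 nn by (auto simp: coprime_commute mult.commute)
    \<comment> \<open>X is the curvature of the neighbour off the chain and Y that of the chain at
      \<open>k = 0\<close>; coprimality prevents both square roots from vanishing.\<close>
    show False
    proof (cases "x = 0")
      case False
      then show False using nonzero nx \<open>X = x\<^sup>2\<close> a0 by auto
    next
      case True
      then have "y \<noteq> 0" using \<open>coprime X Y\<close> \<open>X = x\<^sup>2\<close> \<open>Y = y\<^sup>2\<close> by auto
      then show False using nonzero chain[of 0] \<open>Y = y\<^sup>2\<close> a0 by auto
    qed
  qed
  show ?thesis using nonzero nonline by fastforce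
qed

end
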